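(* Let $A,B,C,D$ be real constant matrices of compatible dimensions, let $\epsilon>0$, and let $$\mathcal{D}_\epsilon=\left\{\boldsymbol{\Delta}=\begin{bmatrix}\boldsymbol{\Delta}_A&\boldsymbol{\Delta}_B&O\\O&O&O\\ \boldsymbol{\Delta}_C&\boldsymbol{\Delta}_D&O\end{bmatrix}:\ \boldsymbol{\Delta}_A,\boldsymbol{\Delta}_B,\boldsymbol{\Delta}_C,\boldsymbol{\Delta}_D\in\mathcal{RH}_\infty,\ \|\boldsymbol{\Delta}\|_\infty<\epsilon\right\}.$$ Let $\mathbf{G}(\boldsymbol{\Delta})$ denote the output-feedback plant with matrices $(A+\boldsymbol{\Delta}_A,\ B+\boldsymbol{\Delta}_B,\ C+\boldsymbol{\Delta}_C,\ D+\boldsymbol{\Delta}_D)$, and let $$\mathcal{K}_\epsilon=\{\mathbf{K} \text{ proper}:\ \mathbf{K}\text{ internally stabilizes }\mathbf{G}(\boldsymbol{\Delta})\ \text{for all }\boldsymbol{\Delta}\in\mathcal{D}_\epsilon\}.$$ Then $\mathcal{K}_\epsilon$ is parameterized by the quadruples $\{\hat{\boldsymbol{\Phi}}_{\mathbf{x}\mathbf{x}}, \hat{\boldsymbol{\Phi}}_{\mathbf{u}\mathbf{x}}, \hat{\boldsymbol{\Phi}}_{\mathbf{x}\mathbf{y}}, \hat{\boldsymbol{\Phi}}_{\mathbf{u}\mathbf{y}}\}$ that satisfy $$\begin{bmatrix} zI-A & -B\end{bmatrix}\begin{bmatrix}\hat{\boldsymbol{\Phi}}_{\mathbf{x}\mathbf{x}}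 & \hat{\boldsymbol{\Phi}}_{\mathbf{x}\mathbf{y}}\\ \hat{\boldsymbol{\Phi}}_{\mathbf{u}\mathbf{x}} & \hat{\boldsymbol{\Phi}}_{\mathbf{u}\mathbf{y}}\end{bmatrix} = \begin{bmatrix} I & O\end{bmatrix},\qquad \begin{bmatrix}\hat{\boldsymbol{\Phi}}_{\mathbf{x}\mathbf{x}} & \hat{\boldsymbol{\Phi}}_{\mathbf{x}\mathbf{y}}\\ \hat{\boldsymbol{\Phi}}_{\mathbf{u}\mathbf{x}} & \hat{\boldsymbol{\Phi}}_{\mathbf{u}\mathbf{y}}\end{bmatrix}\begin{bmatrix} zI-A\\ -C\end{bmatrix}=\begin{bmatrix} I\\ O\end{bmatrix},$$ $$\hat{\boldsymbol{\Phi}}_{\mathbf{x}\mathbf{x}},\hat{\boldsymbol{\Phi}}_{\mathbf{x}\mathbf{y}},\hat{\boldsymbol{\Phi}}_{\mathbf{u}\mathbf{x}}\in z^{-1}\mathcal{RH}_\infty,\qquad \hat{\boldsymbol{\Phi}}_{\mathbf{u}\mathbf{y}}\in\mathcal{RH}_\infty,$$ and $$\left\|\begin{bmatrix}\hat{\boldsymbol{\Phi}}_{\mathbf{x}\mathbf{x}} & \hat{\boldsymbol{\Phi}}_{\mathbf{x}\mathbf{y}}\\ \hat{\boldsymbol{\Phi}}_{\mathbf{u}\mathbf{x}} & \hat{\boldsymbol{\Phi}}_{\mathbf{u}\mathbf{y}}\end{bmatrix}\right\|_\infty\le\epsilon^{-1}.$$ That is, a transfer matrix $\mathbf{K}$ belongs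 to $\mathcal{K}_\epsilon$ if and only if there is such a quadruple for which, with $\hat{\mathbf{K}}_0=\hat{\boldsymbol{\Phi}}_{\mathbf{u}\mathbf{y}}-\hat{\boldsymbol{\Phi}}_{\mathbf{u}\mathbf{x}}\hat{\boldsymbol{\Phi}}_{\mathbf{x}\mathbf{x}}^{-1}\hat{\boldsymbol{\Phi}}_{\mathbf{x}\mathbf{y}}$, the inverse $(I+D\hat{\mathbf{K}}_0)^{-1}$ exists and is proper and $\mathbf{K}=\hat{\mathbf{K}}_0(I+D\hat{\mathbf{K}}_0)^{-1}$.
   Context: Discrete time. Transfer matrices are matrices of real rational functions of $z$; $\mathcal{RH}_\infty$ is the set of stable proper ones (all poles in the open unit disc), $z^{-1}\mathcal{RH}_\infty=\{z^{-1}\mathbf{F}:\mathbf{F}\in\mathcal{RH}_\infty\}$, and $\|\cdot\|_\infty$ is the $H_\infty$ norm (supremum over the unit circle of the largest singular value). $I$ and $O$ are identity and zero matrices. The closed-loop output-feedback system consisting of the plant $\mathbf{G}(\boldsymbol{\Delta})$ and a proper controller $\mathbf{K}$ has internal state $\boldsymbol{\eta}$ stacking state $\mathbf{x}$, control $\mathbf{u}$ and measurement $\mathbf{y}$, and obeys $\boldsymbol{\eta}=\mathbf{R}(\boldsymbol{\Delta})\boldsymbol{\eta}+\mathbf{d}$ with arbitrary external disturbance $\mathbf{d}$ and $$\mathbf{R}(\boldsymbol{\Delta})=\begin{bmatrix} A+\boldsymbol{\Delta}_A+(1-z)I & B+\boldsymbol{\Delta}_B & O\\ O & O & \mathbf{K}\\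 C+\boldsymbol{\Delta}_C & D+\boldsymbol{\Delta}_D & O\end{bmatrix}.$$ The controller $\mathbf{K}$ internally stabilizes $\mathbf{G}(\boldsymbol{\Delta})$ if $(I-\mathbf{R}(\boldsymbol{\Delta}))^{-1}$ exists and lies in $\mathcal{RH}_\infty$. *)

theory Defs
  imports
    "HOL-Analysis.Analysis"
    "HOL-Computational_Algebra.Normalized_Fraction"
    "HOL-Computational_Algebra.Polynomial_Factorial"
    "HOL-Computational_Algebra.Field_as_Ring"
begin

section \<open>Real rational functions\<close>

type_synonym ratfun = "real poly fract"

definition z_var :: ratfun
  where "z_var = to_fract [:0, 1:]"

definition const_rf :: "real \<Rightarrow> ratfun"
  where "const_rf a = to_fract [:a:]"

text \<open>
  Numerator and denominator in lowest terms, with monic denominator.  The poles of a rational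
  function are therefore exactly the complex roots of \<^term>\<open>rf_den\<close>.
\<close>

definition rf_num :: "ratfun \<Rightarrow> real poly"
  where "rf_num f = fst (quot_of_fract f)"

definition rf_den :: "ratfun \<Rightarrow> real poly"
  where "rf_den f = snd (quot_of_fract f)"

definition rf_pole :: "ratfun \<Rightarrow> complex \<Rightarrow> bool"
  where "rf_pole f s \<longleftrightarrow> poly (map_poly complex_of_real (rf_den f)) s = 0"

definition rf_eval :: "ratfun \<Rightarrow> complex \<Rightarrow> complex"
  where "rf_eval f s =
    poly (map_poly complex_of_real (rf_num f)) s / poly (map_poly complex_of_real (rf_den f)) s"

definition rf_proper :: "ratfun \<Rightarrow> bool"
  where "rf_proper f \<longleftrightarrow> degree (rf_num f) \<le> degree (rf_den f)"

definition rf_stable :: "ratfun \<Rightarrow> bool"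
  where "rf_stable f \<longleftrightarrow> (\<forall>s. rf_pole f s \<longrightarrow> cmod s < 1)"


section \<open>Transfer matrices\<close>

type_synonym ('c, 'r) tfmat = "ratfun ^ 'c ^ 'r"

definition const_tf :: "real ^ 'c ^ 'r \<Rightarrow> ('c::finite, 'r::finite) tfmat"
  where "const_tf M = map_matrix const_rf M"

definition tf_proper :: "('c::finite, 'r::finite) tfmat \<Rightarrow> bool"
  where "tf_proper F \<longleftrightarrow> (\<forall>i j. rf_proper (F $ i $ j))"

definition RH_inf :: "('c::finite, 'r::finite) tfmat set"
  where "RH_inf = {F. \<forall>i j. rf_proper (F $ i $ j) \<and> rf_stable (F $ i $ j)}"

definition zinv_RH_inf :: "('c::finite, 'r::finite) tfmat set"
  where "zinv_RH_inf = {map_matrix (\<lambda>f. inverse z_var * f) F | F. F \<in> RH_inf}"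

definition tf_eval :: "('c::finite, 'r::finite) tfmat \<Rightarrow> complex \<Rightarrow> complex ^ 'c ^ 'r"
  where "tf_eval F s = map_matrix (\<lambda>f. rf_eval f s) F"


section \<open>Singular values and the H-infinity norm\<close>

definition conj_transpose :: "complex ^ 'c ^ 'r \<Rightarrow> complex ^ 'r ^ 'c"
  where "conj_transpose M = map_matrix cnj (transpose M)"

text \<open>
  The singular values are the square roots of the eigenvalues of $M^* M$.  For a matrix with fewer
  rows than columns this may add the value 0, which does not affect the largest one.
\<close>

definition singular_value :: "complex ^ 'c ^ 'r \<Rightarrow> real \<Rightarrow> bool"
  where "singular_value M \<sigma> \<longleftrightarrow>
    \<sigma> \<ge> 0 \<and> (\<exists>v. v \<noteq> 0 \<and> (conj_transpose M ** M) *v v = complex_of_real (\<sigma>\<^sup>2) *s v)"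

definition max_singular_value :: "complex ^ 'c ^ 'r \<Rightarrow> real"
  where "max_singular_value M = (GREATEST \<sigma>. singular_value M \<sigma>)"

text \<open>
  The supremum is taken in the reals, so it is meaningful only for matrices that are bounded on
  the unit circle; in particular for those in \<^term>\<open>RH_inf\<close>.
\<close>

definition Hinf_norm :: "('c::finite, 'r::finite) tfmat \<Rightarrow> real"
  where "Hinf_norm F = (SUP s\<in>sphere 0 1. max_singular_value (tf_eval F s))"


section \<open>Block matrices\<close>

text \<open>Block rows and block columns are indexed by sum types.\<close>

definition hcat :: "'a ^ 'c ^ 'r \<Rightarrow> 'a ^ 'd ^ 'r \<Rightarrow> 'a ^ ('c + 'd) ^ 'r"  (infixr "|||" 60)
  where "M ||| N = (\<chi> i j. case j of Inl k \<Rightarrow> M $ i $ k | Inr k \<Rightarrow> N $ i $ k)"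

definition vcat :: "'a ^ 'c ^ 'r \<Rightarrow> 'a ^ 'c ^ 's \<Rightarrow> 'a ^ 'c ^ ('r + 's)"  (infixr "'/'/'/" 55)
  where "M /// N = (\<chi> i. case i of Inl k \<Rightarrow> M $ k | Inr k \<Rightarrow> N $ k)"


section \<open>The closed loop and robust internal stability\<close>

text \<open>
  The index types 'n, 'm and 'p stand for the state, the control and the measurement.
  The plant is given by its (possibly dynamic) matrices, since internal stability refers to
  the internal signals and not only to the input-output map.
\<close>

definition closed_loop ::
  "('n::finite, 'n) tfmat \<Rightarrow> ('m::finite, 'n) tfmat \<Rightarrow> ('n, 'p::finite) tfmat \<Rightarrow> ('m, 'p) tfmat
    \<Rightarrow> ('p, 'm) tfmat \<Rightarrow> ('n + 'm + 'p, 'n + 'm + 'p) tfmat"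
  where "closed_loop A B C D K =
    (A + mat (1 - z_var) ||| B ||| 0) ///
    (0                   ||| 0 ||| K) ///
    (C                   ||| D ||| 0)"

definition internally_stabilizes ::
  "('p::finite, 'm::finite) tfmat \<Rightarrow>
    ('n::finite, 'n) tfmat \<Rightarrow> ('m, 'n) tfmat \<Rightarrow> ('n, 'p) tfmat \<Rightarrow> ('m, 'p) tfmat \<Rightarrow> bool"
  where "internally_stabilizes K A B C D \<longleftrightarrow>
    invertible (mat 1 - closed_loop A B C D K) \<and>
    matrix_inv (mat 1 - closed_loop A B C D K) \<in> RH_inf"

definition uncertainty ::
  "('n::finite, 'n) tfmat \<Rightarrow> ('m::finite, 'n) tfmat \<Rightarrow> ('n, 'p::finite) tfmat \<Rightarrow> ('m, 'p) tfmat
    \<Rightarrow> ('n + 'm + 'p, 'n + 'm + 'p) tfmat"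
  where "uncertainty \<Delta>A \<Delta>B \<Delta>C \<Delta>D =
    (\<Delta>A ||| \<Delta>B ||| 0) ///
    (0  ||| 0  ||| 0) ///
    (\<Delta>C ||| \<Delta>D ||| 0)"

definition uncertainty_set ::
  "real \<Rightarrow> ('n::finite + 'm::finite + 'p::finite, 'n + 'm + 'p) tfmat set"
  where "uncertainty_set \<epsilon> =
    {uncertainty \<Delta>A \<Delta>B \<Delta>C \<Delta>D | \<Delta>A \<Delta>B \<Delta>C \<Delta>D.
       \<Delta>A \<in> RH_inf \<and> \<Delta>B \<in> RH_inf \<and> \<Delta>C \<in> RH_inf \<and> \<Delta>D \<in> RH_inf \<and>
       Hinf_norm (uncertainty \<Delta>A \<Delta>B \<Delta>C \<Delta>D) < \<epsilon>}"

text \<open>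
  The four blocks are determined by the block matrix, so quantifying over the blocks
  is the same as quantifying over the elements of \<^term>\<open>uncertainty_set\<close>.
\<close>

definition robust_controllers ::
  "real ^ 'n::finite ^ 'n \<Rightarrow> real ^ 'm::finite ^ 'n \<Rightarrow> real ^ 'n ^ 'p::finite \<Rightarrow> real ^ 'm ^ 'p
    \<Rightarrow> real \<Rightarrow> ('p, 'm) tfmat set"
  where "robust_controllers A B C D \<epsilon> =
    {K. tf_proper K \<and>
        (\<forall>\<Delta>A \<Delta>B \<Delta>C \<Delta>D.
           (uncertainty \<Delta>A \<Delta>B \<Delta>C \<Delta>D :: ('n + 'm + 'p, 'n + 'm + 'p) tfmat) \<in> uncertainty_set \<epsilon> \<longrightarrow>
           internally_stabilizes K
             (const_tf A + \<Delta>A) (const_tf B + \<Delta>B) (const_tf C + \<Delta>C) (const_tf D + \<Delta>D))}"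

text \<open>
  The inverse of \<open>\<Phi>xx\<close> always exists in \<^term>\<open>nominal_controller\<close> below when it is used with
  stable strictly proper \<open>\<Phi>xx\<close>, \<open>\<Phi>ux\<close> such that \<open>(zI - A) \<Phi>xx - B \<Phi>ux = I\<close>:
  then \<open>z \<Phi>xx\<close> is proper with value \<open>I\<close> at infinity.
\<close>

definition nominal_controller ::
  "('n::finite, 'n) tfmat \<Rightarrow> ('n, 'm::finite) tfmat \<Rightarrow> ('p::finite, 'n) tfmat \<Rightarrow> ('p, 'm) tfmat
    \<Rightarrow> ('p, 'm) tfmat"
  where "nominal_controller \<Phi>xx \<Phi>ux \<Phi>xy \<Phi>uy = \<Phi>uy - \<Phi>ux ** matrix_inv \<Phi>xx ** \<Phi>xy"

end

theory Submission
  imports Defs "HOL-Complex_Analysis.Conformal_Mappings"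
begin

text \<open>
  Let \<open>S = (I - R)\<^sup>-\<^sup>1\<close> be the inverse of the unperturbed closed loop with controller \<open>K\<close>, and let
  \<open>\<Phi>\<close> consist of its blocks from disturbances of state and measurement to state and control.
  The theorem combines two facts.

  \<^item> Algebra: if \<open>S\<close> is stable and proper, then its four blocks \<open>\<Phi>\<close> satisfy the two affine
    constraints and are stable and (strictly) proper, and \<open>K\<close> is recovered from them through
    \<open>K0 = K (I + D K0)\<close> (\<open>nominal_controller_fixed_point\<close>).  The inverse of \<open>I + D K0\<close> is
    \<open>I - D K\<close>, hence proper, and strict properness is read off from loop equations such as
    \<open>z Sxx = I + A Sxx + B Sux\<close>.  Conversely, every such \<open>\<Phi>\<close> arises from the \<open>K\<close> that it
    defines: \<open>closed_loop_inverse_from_maps\<close> writes down the missing blocks of \<open>S\<close>.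

  \<^item> Small gain: the perturbed loop is \<open>I - R - \<Delta> = (I - R) (I - S \<Delta>)\<close>, and \<open>\<Delta>\<close> meets only the
    blocks \<open>\<Phi>\<close> of \<open>S\<close>.  If \<open>\<parallel>\<Phi>\<parallel> \<le> 1/\<epsilon>\<close>, then \<open>I - S \<Delta>\<close> is nonsingular at all points outside
    the open unit disc and at infinity, by the maximum principle, so its inverse is stable and
    proper (\<open>small_gain\<close>).  If \<open>\<parallel>\<Phi>\<parallel> > 1/\<epsilon>\<close>, then \<open>|\<Phi> b| > |b| / \<epsilon>\<close> for some vector \<open>b\<close> at
    some nonreal point of the circle, and a rank-one perturbation of norm less than \<open>\<epsilon>\<close> that maps
    \<open>\<Phi> b\<close> back to \<open>b\<close> makes \<open>I - S \<Delta>\<close> singular there (\<open>norm_bound_necessary\<close>).  Its entries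
    have to be real rational and stable; first-order all-pass functions realize arbitrary phases at
    a nonreal point of the circle.

  Working in the coordinate \<open>w = 1/z\<close> turns the stable proper functions into the rational functions
  without poles on the closed unit disc, so that properness needs no separate treatment.
\<close>

section \<open>Real polynomials at two kinds of points\<close>

text \<open>
  Real polynomials are evaluated at rational functions (in particular at \<open>1/z\<close>) and at
  complex numbers.  Both evaluations are ring homomorphisms for the same reason, and an identity of
  polynomials obtained from the first is read off at a point by the second.
\<close>

locale coeff_hom =
  fixes h :: "real \<Rightarrow> 'a::field"
  assumes h_add: "h (a + b) = h a + h b"
    and h_mult: "h (a * b) = h a * h b"
    and h_1: "h 1 = 1"
begin

lemma h_0: "h 0 = 0"
  by (metis add.right_neutral add_left_cancel h_add)

lemma h_eq_0_iff: "h a = 0 \<longleftrightarrow> a = 0"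
proof
  assume "h a = 0"
  then have "h (a * inverse a) = 0"
    by (simp only: h_mult) simp
  then show "a = 0"
    by (metis h_1 right_inverse zero_neq_one)
qed (simp add: h_0)

definition subst :: "'a \<Rightarrow> real poly \<Rightarrow> 'a"
  where "subst x p = poly (map_poly h p) x"

lemma subst_0 [simp]: "subst x 0 = 0"
  by (simp add: subst_def)

lemma subst_pCons [simp]: "subst x (pCons a p) = h a + x * subst x p"
  by (simp add: subst_def map_poly_pCons h_0)

lemma subst_1 [simp]: "subst x 1 = 1"
  by (simp add: one_pCons h_1 h_0)

lemma subst_add [simp]: "subst x (p + q) = subst x p + subst x q"
  by (induction p q rule: poly_induct2) (simp_all add: h_add algebra_simps h_0)

lemma subst_smult [simp]: "subst x (smult a p) = h a * subst x p"
  by (induction p) (simp_all add: h_mult algebra_simps)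

lemma subst_mult [simp]: "subst x (p * q) = subst x p * subst x q"
  by (induction p) (simp_all add: algebra_simps h_0)

lemma subst_minus [simp]: "subst x (- p) = - subst x p"
  using subst_add[of x p "- p"] by (simp add: eq_neg_iff_add_eq_0 add.commute del: subst_add)

lemma subst_diff [simp]: "subst x (p - q) = subst x p - subst x q"
  using subst_add[of x p "- q"] by simp

lemma subst_monom [simp]: "subst x (monom 1 n) = x ^ n"
  by (simp add: subst_def map_poly_monom h_0 h_1 poly_monom)

text \<open>
  Reversing the coefficients exchanges \<open>x\<close> and \<open>1/x\<close> up to a power of \<open>x\<close>; this is how
  polynomials in \<open>z\<close> become polynomials in \<open>1/z\<close>.
\<close>

lemma subst_reflect:
  assumes "x \<noteq> 0"
  shows "subst x (reflect_poly p) = x ^ degree p * subst (inverse x) p"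
proof -
  have "map_poly h (reflect_poly p) = reflect_poly (map_poly h p)"
    by (rule poly_eqI) (simp add: coeff_map_poly coeff_reflect_poly h_0 degree_map_poly h_eq_0_iff)
  moreover have "degree (map_poly h p) = degree p"
    by (rule degree_map_poly) (simp add: h_eq_0_iff)
  ultimately show ?thesis
    using assms by (simp add: subst_def poly_reflect_poly_nz)
qed

lemma subst_reflect_at_0: "subst 0 (reflect_poly p) = h (lead_coeff p)"
  by (simp add: subst_def poly_0_coeff_0 coeff_map_poly h_0)

end

lemma const_rf_add: "const_rf (a + b) = const_rf a + const_rf b"
  by (simp add: const_rf_def flip: to_fract_add)

lemma const_rf_mult: "const_rf (a * b) = const_rf a * const_rf b"
  by (simp add: const_rf_def flip: to_fract_mult)

lemma const_rf_1: "const_rf 1 = 1"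
  by (simp add: const_rf_def flip: one_pCons)

interpretation rf: coeff_hom const_rf
  by unfold_locales (simp_all add: const_rf_add const_rf_mult const_rf_1)

interpretation cx: coeff_hom complex_of_real
  by unfold_locales simp_all

lemma z_var_nonzero: "z_var \<noteq> 0"
  by (simp add: z_var_def)

lemma rf_subst_z_var: "rf.subst z_var p = to_fract p"
proof (induction p)
  case (pCons a p)
  have "to_fract (pCons a p) = to_fract [:a:] + to_fract [:0, 1:] * to_fract p"
    by (simp flip: to_fract_add to_fract_mult)
  moreover have "rf.subst z_var (pCons a p) = const_rf a + z_var * to_fract p"
    using pCons.IH by simp
  ultimately show ?case
    by (simp only: const_rf_def[of a] z_var_def)
qed simp

abbreviation \<zeta> :: ratfun where "\<zeta> \<equiv> inverse z_var"

text \<open>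
  \<open>\<zeta>\<close> is transcendental over the constants, so a rational function determines its
  representations as a quotient of polynomials in \<open>\<zeta>\<close> up to cross-multiplication.
\<close>

lemma rf_subst_zeta_eq_0_iff: "rf.subst \<zeta> p = 0 \<longleftrightarrow> p = 0"
proof
  assume "rf.subst \<zeta> p = 0"
  then have "rf.subst z_var (reflect_poly p) = 0"
    by (simp add: rf.subst_reflect z_var_nonzero)
  then show "p = 0"
    by (simp add: rf_subst_z_var)
qed simp

lemma rf_num_den: "f = to_fract (rf_num f) / to_fract (rf_den f)"
  unfolding rf_num_def rf_den_def
  by (metis Fract_conv_to_fract Fract_quot_of_fract)

lemma rf_den_nonzero: "rf_den f \<noteq> 0"
  by (simp add: rf_den_def)

lemma cx_subst_num_den_not_both_0: "\<not> (cx.subst s (rf_num f) = 0 \<and> cx.subst s (rf_den f) = 0)"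
proof -
  have "coprime (rf_num f) (rf_den f)"
    by (simp add: rf_num_def rf_den_def coprime_quot_of_fract)
  then obtain a b where "a * rf_num f + b * rf_den f = 1"
    by (metis bezout_coefficients_fst_snd coprime_iff_gcd_eq_1)
  then have "cx.subst s (a * rf_num f + b * rf_den f) = 1"
    by simp
  then show ?thesis by auto
qed

section \<open>Rational functions on the closed unit disc of \<open>1/z\<close>\<close>

text \<open>
  The fraction in lowest terms, rewritten in the coordinate \<open>w = 1/z\<close>: both polynomials are
  multiplied by \<open>w\<close> to the power of the larger degree.  Because subtraction truncates, at most one
  of the two monomials is nontrivial.
\<close>

definition w_num :: "ratfun \<Rightarrow> real poly"
  where "w_num f = monom 1 (degree (rf_den f) - degree (rf_num f)) * reflect_poly (rf_num f)"

definition w_den :: "ratfun \<Rightarrow> real poly"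
  where "w_den f = monom 1 (degree (rf_num f) - degree (rf_den f)) * reflect_poly (rf_den f)"

text \<open>
  The parameter \<open>w\<close> stands for the point \<open>z = 1/w\<close>, with \<open>w = 0\<close> standing for infinity.
  The closed exterior of the unit circle together with infinity becomes the closed unit disc, and
  properness is regularity at one more point of it.
\<close>

definition regular_at :: "ratfun \<Rightarrow> complex \<Rightarrow> bool"
  where "regular_at f w \<longleftrightarrow> cx.subst w (w_den f) \<noteq> 0"

definition value_at :: "ratfun \<Rightarrow> complex \<Rightarrow> complex"
  where "value_at f w = cx.subst w (w_num f) / cx.subst w (w_den f)"

lemma (in coeff_hom) subst_w_num_den:
  assumes "x \<noteq> 0"
  defines "N \<equiv> \<lambda>f. max (degree (rf_num f)) (degree (rf_den f))"
  shows "subst x (w_num f) = x ^ N f * subst (inverse x) (rf_num f)"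
    and "subst x (w_den f) = x ^ N f * subst (inverse x) (rf_den f)"
  using assms
  by (simp_all add: w_num_def w_den_def subst_reflect max_def flip: power_add mult.assoc)

lemma w_num_den: "f = rf.subst \<zeta> (w_num f) / rf.subst \<zeta> (w_den f)" "w_den f \<noteq> 0"
proof -
  have "\<zeta> \<noteq> 0" by (simp add: z_var_nonzero)
  then show "f = rf.subst \<zeta> (w_num f) / rf.subst \<zeta> (w_den f)"
    using rf_num_den[of f]
    by (simp add: rf.subst_w_num_den rf_subst_z_var)
  show "w_den f \<noteq> 0"
    by (simp add: w_den_def rf_den_nonzero)
qed

text \<open>
  At \<open>w \<noteq> 0\<close> this is coprimality of numerator and denominator; at \<open>w = 0\<close> the reflected
  polynomials take the leading coefficients as values, and one of the monomials is 1.
\<close>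

lemma w_num_den_not_both_0: "\<not> (cx.subst w (w_num f) = 0 \<and> cx.subst w (w_den f) = 0)"
proof (cases "w = 0")
  case True
  show ?thesis
  proof (cases "rf_num f = 0")
    case False
    have "degree (rf_den f) - degree (rf_num f) = 0 \<or> degree (rf_num f) - degree (rf_den f) = 0"
      by arith
    then show ?thesis
      using True False rf_den_nonzero[of f]
      by (auto simp: w_num_def w_den_def cx.subst_reflect_at_0)
  next
    case num: True
    then have "f = 0" using rf_num_den[of f] by simp
    then show ?thesis
      by (simp add: w_num_def w_den_def rf_num_def rf_den_def)
  qed
next
  case False
  then show ?thesis
    using cx_subst_num_den_not_both_0 by (simp add: cx.subst_w_num_den)
qed

text \<open>
  Regularity and value can be computed from any quotient representation whose denominator does not
  vanish, not only from the reduced one.  This makes the closure properties that follow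
  one-line computations with fractions: the functions regular at a point form a local ring, and
  \<open>value_at\<close> is its residue map.
\<close>

lemma
  assumes f: "f = rf.subst \<zeta> p / rf.subst \<zeta> q" and q: "cx.subst w q \<noteq> 0"
  shows regular_atI: "regular_at f w"
    and value_atI: "value_at f w = cx.subst w p / cx.subst w q"
proof -
  have "q \<noteq> 0" using q by auto
  have "rf.subst \<zeta> (p * w_den f) = rf.subst \<zeta> (w_num f * q)"
    using f w_num_den[of f] \<open>q \<noteq> 0\<close>
    by (metis frac_eq_eq rf.subst_mult rf_subst_zeta_eq_0_iff)
  then have "rf.subst \<zeta> (p * w_den f - w_num f * q) = 0"
    by simp
  then have "p * w_den f = w_num f * q"
    by (simp only: rf_subst_zeta_eq_0_iff right_minus_eq)
  then have *: "cx.subst w p * cx.subst w (w_den f) = cx.subst w (w_num f) * cx.subst w q"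
    by (metis cx.subst_mult)
  then show "regular_at f w"
    using q w_num_den_not_both_0[of w f] by (auto simp: regular_at_def)
  then show "value_at f w = cx.subst w p / cx.subst w q"
    using q * by (simp add: value_at_def regular_at_def frac_eq_eq)
qed

lemma regular_atE:
  assumes "regular_at f w"
  obtains p q where "f = rf.subst \<zeta> p / rf.subst \<zeta> q" "cx.subst w q \<noteq> 0" "rf.subst \<zeta> q \<noteq> 0"
    "value_at f w = cx.subst w p / cx.subst w q"
  using assms that[OF w_num_den(1)] w_num_den(2)
  by (auto simp: regular_at_def value_at_def rf_subst_zeta_eq_0_iff)

lemma
  assumes "regular_at f w" "regular_at g w"
  shows regular_at_add: "regular_at (f + g) w"
    and value_at_add: "value_at (f + g) w = value_at f w + value_at g w"
    and regular_at_mult: "regular_at (f * g) w"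
    and value_at_mult: "value_at (f * g) w = value_at f w * value_at g w"
proof -
  obtain p q where f: "f = rf.subst \<zeta> p / rf.subst \<zeta> q" "cx.subst w q \<noteq> 0" "rf.subst \<zeta> q \<noteq> 0"
    "value_at f w = cx.subst w p / cx.subst w q"
    using assms(1) by (rule regular_atE)
  obtain p' q' where g: "g = rf.subst \<zeta> p' / rf.subst \<zeta> q'" "cx.subst w q' \<noteq> 0" "rf.subst \<zeta> q' \<noteq> 0"
    "value_at g w = cx.subst w p' / cx.subst w q'"
    using assms(2) by (rule regular_atE)
  have nz: "cx.subst w (q * q') \<noteq> 0"
    using f g by simp
  have sum: "f + g = rf.subst \<zeta> (p * q' + p' * q) / rf.subst \<zeta> (q * q')"
    unfolding f(1) g(1) rf.subst_add rf.subst_mult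
    by (rule add_frac_eq[OF f(3) g(3)])
  show "regular_at (f + g) w"
    using sum nz by (rule regular_atI)
  show "value_at (f + g) w = value_at f w + value_at g w"
    unfolding value_atI[OF sum nz] f(4) g(4) cx.subst_add cx.subst_mult
    by (rule add_frac_eq[OF f(2) g(2), symmetric])
  have prod: "f * g = rf.subst \<zeta> (p * p') / rf.subst \<zeta> (q * q')"
    unfolding f(1) g(1) by simp
  show "regular_at (f * g) w"
    using prod nz by (rule regular_atI)
  show "value_at (f * g) w = value_at f w * value_at g w"
    unfolding value_atI[OF prod nz] f(4) g(4) by simp
qed

lemma regular_at_const [simp]: "regular_at (const_rf c) w"
  and value_at_const [simp]: "value_at (const_rf c) w = complex_of_real c"
proof -
  have *: "const_rf c = rf.subst \<zeta> [:c:] / rf.subst \<zeta> 1" "cx.subst w 1 \<noteq> 0"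
    by simp_all
  show "regular_at (const_rf c) w"
    using * by (rule regular_atI)
  show "value_at (const_rf c) w = complex_of_real c"
    using value_atI[OF *] by simp
qed

lemma regular_at_zeta [simp]: "regular_at \<zeta> w"
  and value_at_zeta [simp]: "value_at \<zeta> w = w"
proof -
  have *: "\<zeta> = rf.subst \<zeta> [:0, 1:] / rf.subst \<zeta> 1" "cx.subst w 1 \<noteq> 0"
    by (simp_all add: rf.h_0 const_rf_1)
  show "regular_at \<zeta> w"
    using * by (rule regular_atI)
  show "value_at \<zeta> w = w"
    using value_atI[OF *] by simp
qed

lemma
  assumes "regular_at f w" "value_at f w \<noteq> 0"
  shows regular_at_inverse: "regular_at (inverse f) w"
    and value_at_inverse: "value_at (inverse f) w = inverse (value_at f w)"
proof -
  obtain p q where f: "f = rf.subst \<zeta> p / rf.subst \<zeta> q" "cx.subst w q \<noteq> 0" 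
    "value_at f w = cx.subst w p / cx.subst w q"
    using assms(1) by (rule regular_atE)
  have *: "inverse f = rf.subst \<zeta> q / rf.subst \<zeta> p" "cx.subst w p \<noteq> 0"
    using f assms(2) by auto
  show "regular_at (inverse f) w"
    using * by (rule regular_atI)
  show "value_at (inverse f) w = inverse (value_at f w)"
    using value_atI[OF *] f by simp
qed

lemma regular_at_0 [simp]: "regular_at 0 w" and value_at_0 [simp]: "value_at 0 w = 0"
  using regular_at_const[of 0] value_at_const[of 0] by (simp_all add: rf.h_0)

lemma regular_at_1 [simp]: "regular_at 1 w" and value_at_1 [simp]: "value_at 1 w = 1"
  using regular_at_const[of 1] value_at_const[of 1] by (simp_all add: const_rf_1)

lemma
  assumes "regular_at f w"
  shows regular_at_minus: "regular_at (- f) w"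
    and value_at_minus: "value_at (- f) w = - value_at f w"
proof -
  have "const_rf (- 1) = - 1"
    using const_rf_add[of 1 "- 1"]
    by (metis add.right_inverse const_rf_1 minus_unique rf.h_0)
  then show "regular_at (- f) w" "value_at (- f) w = - value_at f w"
    using regular_at_mult[OF regular_at_const[of "- 1"] assms]
      value_at_mult[OF regular_at_const[of "- 1"] assms] value_at_const[of "- 1" w] by simp_all
qed

lemma
  assumes "regular_at f w" "regular_at g w"
  shows regular_at_diff: "regular_at (f - g) w"
    and value_at_diff: "value_at (f - g) w = value_at f w - value_at g w"
  using regular_at_add[OF assms(1) regular_at_minus[OF assms(2)]]
    value_at_add[OF assms(1) regular_at_minus[OF assms(2)]] value_at_minus[OF assms(2)]
  by simp_all

lemma
  assumes "\<And>i. i \<in> I \<Longrightarrow> regular_at (f i) w"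
  shows regular_at_sum: "regular_at (\<Sum>i\<in>I. f i) w"
    and value_at_sum: "value_at (\<Sum>i\<in>I. f i) w = (\<Sum>i\<in>I. value_at (f i) w)"
proof -
  have "regular_at (\<Sum>i\<in>I. f i) w \<and> value_at (\<Sum>i\<in>I. f i) w = (\<Sum>i\<in>I. value_at (f i) w)"
    using assms
    by (induction I rule: infinite_finite_induct) (auto simp: regular_at_add value_at_add)
  then show "regular_at (\<Sum>i\<in>I. f i) w"
      "value_at (\<Sum>i\<in>I. f i) w = (\<Sum>i\<in>I. value_at (f i) w)"
    by auto
qed

lemma
  assumes "\<And>i. i \<in> I \<Longrightarrow> regular_at (f i) w"
  shows regular_at_prod: "regular_at (\<Prod>i\<in>I. f i) w"
    and value_at_prod: "value_at (\<Prod>i\<in>I. f i) w = (\<Prod>i\<in>I. value_at (f i) w)"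
proof -
  have "regular_at (\<Prod>i\<in>I. f i) w \<and> value_at (\<Prod>i\<in>I. f i) w = (\<Prod>i\<in>I. value_at (f i) w)"
    using assms
    by (induction I rule: infinite_finite_induct) (auto simp: regular_at_mult value_at_mult)
  then show "regular_at (\<Prod>i\<in>I. f i) w"
      "value_at (\<Prod>i\<in>I. f i) w = (\<Prod>i\<in>I. value_at (f i) w)"
    by auto
qed

lemma rf_proper_iff: "rf_proper f \<longleftrightarrow> regular_at f 0"
  using rf_den_nonzero[of f]
  by (auto simp: rf_proper_def regular_at_def w_den_def cx.subst_reflect_at_0)

lemma rf_pole_iff: "w \<noteq> 0 \<Longrightarrow> rf_pole f (inverse w) \<longleftrightarrow> \<not> regular_at f w"
  by (simp add: rf_pole_def regular_at_def cx.subst_w_num_den flip: cx.subst_def)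

lemma rf_eval_eq_value_at: "w \<noteq> 0 \<Longrightarrow> rf_eval f (inverse w) = value_at f w"
  by (simp add: rf_eval_def value_at_def cx.subst_w_num_den flip: cx.subst_def)

text \<open>
  The poles lie in the open unit disc iff there is none with \<open>|z| \<ge> 1\<close>, that is, with
  \<open>0 < |w| \<le> 1\<close>; properness supplies \<open>w = 0\<close>.
\<close>

lemma proper_stable_iff:
  "rf_proper f \<and> rf_stable f \<longleftrightarrow> (\<forall>w. cmod w \<le> 1 \<longrightarrow> regular_at f w)"
proof
  assume L: "rf_proper f \<and> rf_stable f"
  show "\<forall>w. cmod w \<le> 1 \<longrightarrow> regular_at f w"
  proof (intro allI impI)
    fix w :: complex assume w: "cmod w \<le> 1"
    show "regular_at f w"
    proof (cases "w = 0")
      case False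
      then have "cmod (inverse w) \<ge> 1"
        using w by (simp add: norm_inverse one_le_inverse)
      then show ?thesis
        using L rf_pole_iff[OF False, of f] by (metis rf_stable_def not_le)
    qed (use L rf_proper_iff in simp)
  qed
next
  assume R: "\<forall>w. cmod w \<le> 1 \<longrightarrow> regular_at f w"
  have "cmod s < 1" if "rf_pole f s" for s
  proof (rule ccontr)
    assume "\<not> cmod s < 1"
    moreover from this have "s \<noteq> 0" by auto
    ultimately have "regular_at f (inverse s)" 
      using R by (simp add: norm_inverse inverse_le_1_iff)
    then show False
      using that rf_pole_iff[of "inverse s" f] \<open>s \<noteq> 0\<close> by simp
  qed
  then show "rf_proper f \<and> rf_stable f"
    using R by (simp add: rf_proper_iff rf_stable_def)
qed

text \<open>
  Makes the maximum principle applicable to the entries of stable proper matrices.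
\<close>

lemma holomorphic_on_value_at:
  assumes "\<And>w. w \<in> S \<Longrightarrow> regular_at f w"
  shows "value_at f holomorphic_on S"
proof -
  have "(\<lambda>w. cx.subst w p) holomorphic_on S" for p
    unfolding cx.subst_def by (intro holomorphic_intros)
  then show ?thesis
    unfolding value_at_def[abs_def]
    using assms by (intro holomorphic_intros) (auto simp: regular_at_def)
qed

section \<open>Singular values and the operator norm\<close>

lemma inner_complex_eq: "(a::complex) \<bullet> b = Re (cnj a * b)"
  by (simp add: inner_complex_def)

text \<open>
  The inner product of complex vectors is the real part of the Hermitian one.  For it the
  conjugate transpose is still the adjoint, and real inner products suffice below.
\<close>

lemma inner_conj_transpose: "(M *v x) \<bullet> y = x \<bullet> (conj_transpose M *v y)"
  for M :: "complex ^ 'c::finite ^ 'r::finite"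
proof -
  have "(M *v x) \<bullet> y = (\<Sum>i\<in>UNIV. \<Sum>j\<in>UNIV. Re (cnj (M $ i $ j * x $ j) * y $ i))"
    by (simp add: inner_vec_def inner_complex_eq matrix_vector_mult_def sum_distrib_right del: complex_cnj_mult)
  also have "\<dots> = (\<Sum>j\<in>UNIV. \<Sum>i\<in>UNIV. Re (cnj (x $ j) * (conj_transpose M $ j $ i * y $ i)))"
    by (subst sum.swap) (simp add: conj_transpose_def transpose_def mult_ac)
  also have "\<dots> = x \<bullet> (conj_transpose M *v y)"
    by (simp add: inner_vec_def inner_complex_eq matrix_vector_mult_def sum_distrib_left)
  finally show ?thesis .
qed

abbreviation operator_norm :: "complex ^ 'c ^ 'r \<Rightarrow> real"
  where "operator_norm M \<equiv> onorm (\<lambda>v. M *v v)"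

lemma bounded_linear_matrix: "bounded_linear (\<lambda>v. M *v v)" for M :: "complex ^ 'c ^ 'r"
  by (simp add: linear_conv_bounded_linear[symmetric])

lemma norm_le_operator_norm: "norm (M *v v) \<le> operator_norm M * norm v"
  for M :: "complex ^ 'c ^ 'r"
  by (rule onorm[OF bounded_linear_matrix])

lemma operator_norm_attained:
  fixes M :: "complex ^ 'c ^ 'r"
  obtains v where "norm v = 1" "norm (M *v v) = operator_norm M"
proof -
  have "sphere (0::complex ^ 'c) 1 \<noteq> {}"
    using vector_choose_size[of 1] by auto
  moreover have "continuous_on (sphere 0 1) (\<lambda>v. norm (M *v v))"
    by (intro continuous_intros linear_continuous_on bounded_linear_matrix)
  ultimately obtain v where v: "norm v = 1" and max: "\<And>x. norm x = 1 \<Longrightarrow> norm (M *v x) \<le> norm (M *v v)"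
    using continuous_attains_sup[OF compact_sphere] by (metis mem_sphere_0)
  have "norm (M *v x) \<le> norm (M *v v) * norm x" for x
  proof (cases "x = 0")
    case False
    have "norm (M *v (x /\<^sub>R norm x)) \<le> norm (M *v v)"
      using False by (intro max) simp
    then show ?thesis
      using False by (simp add: linear_scale[OF matrix_vector_mul_linear] field_simps)
  qed simp
  then have "operator_norm M \<le> norm (M *v v)"
    by (intro onorm_bound) auto
  moreover have "norm (M *v v) \<le> operator_norm M"
    using norm_le_operator_norm[of M v] v by simp
  ultimately show ?thesis
    using that v by simp
qed

lemma of_real_vector_smult: "complex_of_real c *s v = c *\<^sub>R v"
  by (simp add: vec_eq_iff scaleR_conv_of_real[symmetric])

text \<open>
  A unit vector \<open>v\<close> at which \<open>|M v|\<close> attains the operator norm \<open>N\<close> is an eigenvector: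
  \<open>|M\<^sup>* M v - N\<^sup>2 v|\<^sup>2 = |M\<^sup>* M v|\<^sup>2 - N\<^sup>4\<close>, and this is at most 0 because the
  adjoint has operator norm at most \<open>N\<close>.
\<close>

lemma max_singular_value_eq_operator_norm: "max_singular_value M = operator_norm M"
  for M :: "complex ^ 'c::finite ^ 'r::finite"
  unfolding max_singular_value_def
proof (rule Greatest_equality)
  let ?N = "operator_norm M" and ?M' = "conj_transpose M"
  have nonneg: "?N \<ge> 0"
    by (rule onorm_pos_le[OF bounded_linear_matrix])
  have adj: "norm (?M' *v y) \<le> ?N * norm y" for y
  proof (cases "?M' *v y = 0")
    case False
    have "(norm (?M' *v y))\<^sup>2 = (M *v (?M' *v y)) \<bullet> y"
      by (simp add: inner_conj_transpose power2_norm_eq_inner)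
    also have "\<dots> \<le> norm (M *v (?M' *v y)) * norm y"
      by (rule norm_cauchy_schwarz)
    also have "\<dots> \<le> ?N * norm (?M' *v y) * norm y"
      by (intro mult_right_mono norm_le_operator_norm) simp
    finally show ?thesis
      using False by (simp add: power2_eq_square)
  qed (simp add: nonneg)
  obtain v where v: "norm v = 1" "norm (M *v v) = ?N"
    by (rule operator_norm_attained)
  let ?H = "?M' *v (M *v v)"
  have "norm ?H \<le> ?N\<^sup>2"
    using adj[of "M *v v"] v by (simp add: power2_eq_square)
  then have le: "(norm ?H)\<^sup>2 \<le> (?N\<^sup>2)\<^sup>2"
    by (intro power_mono) auto
  have "v \<bullet> ?H = ?N\<^sup>2"
    using v by (simp add: dot_square_norm flip: inner_conj_transpose)
  moreover have "(norm (x - c *\<^sub>R y))\<^sup>2 = (norm x)\<^sup>2 - 2 * c * (y \<bullet> x) + c\<^sup>2 * (norm y)\<^sup>2"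
    for x y :: "complex ^ 'c" and c
    unfolding power2_norm_eq_inner
    by (simp add: inner_diff_left inner_diff_right inner_commute power2_eq_square algebra_simps)
  ultimately have "(norm (?H - ?N\<^sup>2 *\<^sub>R v))\<^sup>2 = (norm ?H)\<^sup>2 - (?N\<^sup>2)\<^sup>2"
    using v(1) by (simp add: power2_eq_square)
  with le have "?H = ?N\<^sup>2 *\<^sub>R v"
    by (metis diff_le_0_iff_le eq_iff_diff_eq_0 norm_eq_zero power2_less_eq_zero_iff)
  moreover have "v \<noteq> 0" using v by auto
  ultimately show "singular_value M ?N"
    using nonneg by (auto simp: singular_value_def of_real_vector_smult matrix_vector_mul_assoc simp flip: of_real_power)
next
  fix \<sigma> assume "singular_value M \<sigma>"
  then obtain v where v: "\<sigma> \<ge> 0" "v \<noteq> 0" "conj_transpose M *v (M *v v) = \<sigma>\<^sup>2 *\<^sub>R v"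
    by (auto simp: singular_value_def of_real_vector_smult matrix_vector_mul_assoc simp flip: of_real_power)
  have "(norm (M *v v))\<^sup>2 = (\<sigma> * norm v)\<^sup>2"
    using v by (simp add: power2_norm_eq_inner inner_conj_transpose power_mult_distrib)
  then have "norm (M *v v) = \<sigma> * norm v"
    using v by (simp add: power2_eq_iff_nonneg)
  then show "\<sigma> \<le> operator_norm M"
    using norm_le_operator_norm[of M v] v by simp
qed

section \<open>Stable proper matrices and the \<open>H\<^sub>\<infinity>\<close> norm\<close>

lemma
  assumes "invertible A"
  shows matrix_inv_right: "A ** matrix_inv A = mat 1"
    and matrix_inv_left: "matrix_inv A ** A = mat 1"
  using someI_ex[OF assms[unfolded invertible_def]] by (simp_all add: matrix_inv_def)

lemma
  fixes A :: "'a::field ^ 'n ^ 'n"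
  assumes "A ** B = mat 1"
  shows invertibleI_right: "invertible A"
    and matrix_inv_eqI: "matrix_inv A = B"
proof -
  show inv: "invertible A"
    using assms by (auto simp: invertible_right_inverse)
  show "matrix_inv A = B"
    by (metis assms inv matrix_inv_left matrix_mul_assoc matrix_mul_lid matrix_mul_rid)
qed

definition mat_regular_at :: "('c::finite, 'r::finite) tfmat \<Rightarrow> complex \<Rightarrow> bool"
  where "mat_regular_at F w \<longleftrightarrow> (\<forall>i j. regular_at (F $ i $ j) w)"

definition mat_at :: "('c::finite, 'r::finite) tfmat \<Rightarrow> complex \<Rightarrow> complex ^ 'c ^ 'r"
  where "mat_at F w = map_matrix (\<lambda>f. value_at f w) F"

lemma mat_at_nth [simp]: "mat_at F w $ i $ j = value_at (F $ i $ j) w"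
  by (simp add: mat_at_def)

lemma tf_proper_iff: "tf_proper F \<longleftrightarrow> mat_regular_at F 0"
  by (simp add: tf_proper_def mat_regular_at_def rf_proper_iff)

lemma RH_inf_iff: "F \<in> RH_inf \<longleftrightarrow> (\<forall>w. cmod w \<le> 1 \<longrightarrow> mat_regular_at F w)"
  by (auto simp: RH_inf_def mat_regular_at_def proper_stable_iff)

lemma RH_infD: "F \<in> RH_inf \<Longrightarrow> cmod w \<le> 1 \<Longrightarrow> mat_regular_at F w"
  by (simp add: RH_inf_iff)

lemma tf_eval_eq_mat_at: "w \<noteq> 0 \<Longrightarrow> tf_eval F (inverse w) = mat_at F w"
  by (simp add: vec_eq_iff tf_eval_def rf_eval_eq_value_at)

lemma
  assumes "mat_regular_at F w" "mat_regular_at G w"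
  shows mat_regular_at_add: "mat_regular_at (F + G) w"
    and mat_at_add: "mat_at (F + G) w = mat_at F w + mat_at G w"
    and mat_regular_at_diff: "mat_regular_at (F - G) w"
    and mat_at_diff: "mat_at (F - G) w = mat_at F w - mat_at G w"
  using assms
  by (simp_all add: mat_regular_at_def vec_eq_iff regular_at_add value_at_add regular_at_diff value_at_diff)

lemma
  assumes "mat_regular_at F w" "mat_regular_at G w"
  shows mat_regular_at_mult: "mat_regular_at (F ** G) w"
    and mat_at_mult: "mat_at (F ** G) w = mat_at F w ** mat_at G w"
  using assms
  by (simp_all add: mat_regular_at_def vec_eq_iff matrix_matrix_mult_def regular_at_sum value_at_sum
      regular_at_mult value_at_mult)

lemma mat_regular_at_mat_1 [simp]: "mat_regular_at (mat 1) w"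
  and mat_at_mat_1 [simp]: "mat_at (mat 1) w = mat 1"
  by (simp_all add: mat_regular_at_def mat_def vec_eq_iff)

lemma mat_regular_at_0 [simp]: "mat_regular_at 0 w"
  and mat_at_0 [simp]: "mat_at 0 w = 0"
  by (simp_all add: mat_regular_at_def vec_eq_iff)

lemma mat_regular_at_const_tf [simp]: "mat_regular_at (const_tf M) w"
  by (simp add: mat_regular_at_def const_tf_def)

lemma RH_inf_closed:
  shows RH_inf_add: "F \<in> RH_inf \<Longrightarrow> G \<in> RH_inf \<Longrightarrow> F + G \<in> RH_inf"
    and RH_inf_diff: "F \<in> RH_inf \<Longrightarrow> G \<in> RH_inf \<Longrightarrow> F - G \<in> RH_inf"
    and RH_inf_mult: "F \<in> RH_inf \<Longrightarrow> H \<in> RH_inf \<Longrightarrow> F ** H \<in> RH_inf"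
    and RH_inf_mat_1: "mat 1 \<in> RH_inf"
    and RH_inf_0: "0 \<in> RH_inf"
    and RH_inf_const_tf: "const_tf M \<in> RH_inf"
  by (simp_all add: RH_inf_iff mat_regular_at_add mat_regular_at_diff mat_regular_at_mult)

lemma sign_rf: "of_int (sign p) = (const_rf (of_int (sign p)) :: ratfun)"
  by (simp add: sign_def const_rf_1) (metis add.right_inverse const_rf_1 const_rf_add minus_unique rf.h_0)

lemma
  fixes F :: "('n::finite, 'n) tfmat"
  assumes "mat_regular_at F w"
  shows regular_at_det: "regular_at (det F) w"
    and value_at_det: "value_at (det F) w = det (mat_at F w)"
proof -
  have *: "regular_at (\<Prod>i\<in>UNIV. F $ i $ p i) w"
    "value_at (\<Prod>i\<in>UNIV. F $ i $ p i) w = (\<Prod>i\<in>UNIV. value_at (F $ i $ p i) w)" for p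
    using assms by (auto simp: mat_regular_at_def intro!: regular_at_prod value_at_prod)
  show "regular_at (det F) w"
    unfolding det_def sign_rf by (intro regular_at_sum regular_at_mult regular_at_const *)
  show "value_at (det F) w = det (mat_at F w)"
    unfolding det_def sign_rf
    by (subst value_at_sum) (auto simp: value_at_mult * intro: regular_at_mult)
qed

text \<open>
  By Cramer's rule the entries of the inverse are determinants of matrices that are regular at
  \<open>w\<close>, divided by \<open>det F\<close>, whose value at \<open>w\<close> is nonzero.
\<close>

lemma
  fixes F :: "('n::finite, 'n) tfmat"
  assumes reg: "mat_regular_at F w" and nz: "det (mat_at F w) \<noteq> 0"
  shows invertible_if_value_nonsingular: "invertible F"
    and mat_regular_at_matrix_inv: "mat_regular_at (matrix_inv F) w"
proof -
  have det: "det F \<noteq> 0"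
    using nz value_at_det[OF reg] by auto
  then show inv: "invertible F"
    by (simp add: invertible_det_nz)
  have det_inv: "regular_at (inverse (det F)) w"
    using nz value_at_det[OF reg] regular_at_det[OF reg] by (intro regular_at_inverse) auto
  have "regular_at (matrix_inv F $ i $ k) w" for i k
  proof -
    let ?b = "axis k 1 :: ratfun ^ 'n"
    have "F *v (matrix_inv F *v ?b) = ?b"
      using inv by (simp add: matrix_vector_mul_assoc matrix_inv_right)
    then have "matrix_inv F *v ?b = (\<chi> k. det (\<chi> i j. if j = k then ?b $ i else F $ i $ j) / det F)"
      by (simp only: cramer[OF det])
    moreover have "matrix_inv F $ i $ k = (matrix_inv F *v ?b) $ i"
      by (simp add: matrix_vector_mult_def axis_def if_distrib cong: if_cong)
    ultimately have "matrix_inv F $ i $ k = det (\<chi> i' j. if j = i then ?b $ i' else F $ i' $ j) * inverse (det F)"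
      by (simp add: divide_inverse)
    moreover have "regular_at (det (\<chi> i' j. if j = i then ?b $ i' else F $ i' $ j)) w"
      using reg by (intro regular_at_det) (auto simp: mat_regular_at_def axis_def)
    ultimately show ?thesis
      using det_inv by (simp add: regular_at_mult)
  qed
  then show "mat_regular_at (matrix_inv F) w"
    by (simp add: mat_regular_at_def)
qed

lemma matrix_inv_in_RH_inf:
  fixes F :: "('n::finite, 'n) tfmat"
  assumes F: "F \<in> RH_inf"
    and nonsing: "\<And>w v. cmod w \<le> 1 \<Longrightarrow> mat_at F w *v v = 0 \<Longrightarrow> v = 0"
  shows "invertible F" and "matrix_inv F \<in> RH_inf"
proof -
  have det: "det (mat_at F w) \<noteq> 0" if "cmod w \<le> 1" for w
    using nonsing[OF that] by (metis invertible_det_nz invertible_left_inverse matrix_left_invertible_ker)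
  show "invertible F"
    using invertible_if_value_nonsingular[OF RH_infD[OF F] det, of 0] by simp
  show "matrix_inv F \<in> RH_inf"
    unfolding RH_inf_iff using mat_regular_at_matrix_inv[OF RH_infD[OF F] det] by blast
qed

lemma continuous_on_mat_at:
  assumes F: "F \<in> RH_inf" and f: "continuous_on S f" and g: "continuous_on S g" 
    and S: "\<And>x. x \<in> S \<Longrightarrow> cmod (f x) \<le> 1"
  shows "continuous_on S (\<lambda>x. mat_at F (f x) *v g x)"
proof -
  have *: "continuous_on S (\<lambda>x. value_at (F $ i $ j) (f x))" for i j
  proof -
    have "continuous_on (cball 0 1) (value_at (F $ i $ j))"
      using RH_infD[OF F]
      by (intro holomorphic_on_imp_continuous_on holomorphic_on_value_at) (auto simp: mat_regular_at_def)
    then show ?thesis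
      by (rule continuous_on_compose2) (use f S in auto)
  qed
  show ?thesis
    unfolding matrix_vector_mult_def mat_at_nth
    by (intro continuous_intros * g continuous_on_vec_lambda continuous_on_component)
qed

text \<open>
  Inversion maps the unit circle to itself, so on the circle it does not matter which of the two
  coordinates is used.
\<close>

lemma Hinf_norm_eq: "Hinf_norm F = (SUP w\<in>sphere 0 1. operator_norm (mat_at F w))"
proof -
  have "(\<lambda>s. max_singular_value (tf_eval F s)) ` sphere 0 1 = (\<lambda>w. operator_norm (mat_at F w)) ` sphere 0 1"
  proof -
    have "sphere 0 1 = inverse ` sphere (0::complex) 1"
    proof -
      have "inverse w \<in> sphere (0::complex) 1" if "w \<in> sphere 0 1" for w
        using that by (simp add: norm_inverse)
      then show ?thesis
        by (metis (no_types, lifting) image_subset_iff inverse_inverse_eq subsetI subset_antisym image_iff)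
    qed
    moreover have "max_singular_value (tf_eval F (inverse w)) = operator_norm (mat_at F w)"
      if "w \<in> sphere 0 1" for w
      using that by (subst tf_eval_eq_mat_at) (auto simp: max_singular_value_eq_operator_norm)
    ultimately show ?thesis
      by (metis (no_types, lifting) image_cong image_image)
  qed
  then show ?thesis
    by (simp add: Hinf_norm_def)
qed

text \<open>
  The supremum is one of reals, so the bound needs the operator norms to be bounded on the circle;
  they are, by compactness of the set of pairs of a point of the circle and a unit vector.
\<close>

lemma operator_norm_le_Hinf_norm:
  fixes F :: "('a::finite, 'r::finite) tfmat"
  assumes F: "F \<in> RH_inf" and w: "cmod w = 1"
  shows "operator_norm (mat_at F w) \<le> Hinf_norm F"
proof -
  let ?S = "sphere (0::complex) 1 \<times> sphere (0::complex ^ 'a) 1"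
  have "continuous_on ?S (\<lambda>x. mat_at F (fst x) *v snd x)"
    by (rule continuous_on_mat_at[OF F]) (auto intro!: continuous_intros)
  moreover have "compact ?S"
    by (intro compact_Times compact_sphere)
  ultimately have "bounded ((\<lambda>x. mat_at F (fst x) *v snd x) ` ?S)"
    by (rule compact_imp_bounded[OF compact_continuous_image])
  then obtain b where b: "\<And>w v. cmod w = 1 \<Longrightarrow> norm v = 1 \<Longrightarrow> norm (mat_at F w *v v) \<le> b"
    unfolding bounded_iff by fastforce
  have "operator_norm (mat_at F w) \<le> b" if "cmod w = 1" for w
    by (metis b operator_norm_attained that)
  then have "bdd_above ((\<lambda>w. operator_norm (mat_at F w)) ` sphere 0 1)"
    by (intro bdd_aboveI2) auto
  then show ?thesis
    unfolding Hinf_norm_eq using w by (intro cSUP_upper) auto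
qed

lemma Hinf_norm_leI:
  assumes "\<And>w v. cmod w = 1 \<Longrightarrow> norm (mat_at F w *v v) \<le> c * norm v"
  shows "Hinf_norm F \<le> c"
  unfolding Hinf_norm_eq
proof (rule cSUP_least)
  show "sphere (0::complex) 1 \<noteq> {}"
    using vector_choose_size[of 1] by auto
  fix w :: complex assume w: "w \<in> sphere 0 1"
  obtain v where "norm v = 1" "norm (mat_at F w *v v) = operator_norm (mat_at F w)"
    by (rule operator_norm_attained)
  then show "operator_norm (mat_at F w) \<le> c"
    using assms[of w v] w by simp
qed

text \<open>
  The maximum principle for matrices.  With \<open>u = F(w) v\<close> fixed, the holomorphic function
  \<open>x \<mapsto> \<langle>u, F(x) v\<rangle>\<close> takes the value \<open>|u|\<^sup>2\<close> at \<open>w\<close>, while its real part on the circle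
  is at most \<open>|u|\<close> times \<open>Hinf_norm F * norm v\<close>.
\<close>

lemma Hinf_norm_bounds_disc:
  fixes F :: "('c::finite, 'r::finite) tfmat"
  assumes F: "F \<in> RH_inf" and w: "cmod w \<le> 1"
  shows "norm (mat_at F w *v v) \<le> Hinf_norm F * norm v"
proof (cases "mat_at F w *v v = 0")
  case True
  have "0 \<le> Hinf_norm F"
    using operator_norm_le_Hinf_norm[OF F, of 1] onorm_pos_le[OF bounded_linear_matrix, of "mat_at F 1"]
    by simp
  then show ?thesis by (simp add: True)
next
  case False
  define u where "u = mat_at F w *v v"
  define f where "f = (\<lambda>x. \<Sum>i\<in>UNIV. \<Sum>j\<in>UNIV. cnj (u $ i) * (value_at (F $ i $ j) x * v $ j))"
  have f: "Re (f x) = u \<bullet> (mat_at F x *v v)" for x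
    by (simp add: f_def inner_vec_def inner_complex_eq matrix_vector_mult_def sum_distrib_left)
  have hol: "f holomorphic_on cball 0 1"
    unfolding f_def using RH_infD[OF F]
    by (intro holomorphic_intros holomorphic_on_value_at) (auto simp: mat_regular_at_def)
  have "Re (f w) \<le> norm u * (Hinf_norm F * norm v)"
  proof (rule maximum_real_frontier[where S = "cball 0 1" and f = f])
    show "f holomorphic_on interior (cball 0 1)"
      using hol interior_subset by (rule holomorphic_on_subset)
    show "continuous_on (closure (cball 0 1)) f"
      using hol by (simp add: holomorphic_on_imp_continuous_on)
    fix x :: complex assume "x \<in> frontier (cball 0 1)"
    then have x: "cmod x = 1" by simp
    have "norm (mat_at F x *v v) \<le> Hinf_norm F * norm v"
      using norm_le_operator_norm[of "mat_at F x" v] operator_norm_le_Hinf_norm[OF F x]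
      by (meson mult_right_mono norm_ge_zero order_trans)
    then show "Re (f x) \<le> norm u * (Hinf_norm F * norm v)"
      unfolding f using norm_cauchy_schwarz[of u "mat_at F x *v v"]
      by (meson mult_left_mono norm_ge_zero order_trans)
  qed (use w in auto)
  then have "norm u * norm u \<le> norm u * (Hinf_norm F * norm v)"
    by (simp add: f norm_eq_sqrt_inner u_def[symmetric])
  then show ?thesis
    using False by (simp add: u_def)
qed

section \<open>Block matrices\<close>

lemma sum_UNIV_sum_type:
  "(\<Sum>k\<in>UNIV. f k) = (\<Sum>k\<in>UNIV. f (Inl k)) + (\<Sum>k\<in>UNIV. f (Inr k))"
  for f :: "'a::finite + 'b::finite \<Rightarrow> 'c::comm_monoid_add"
  by (simp add: sum.Plus flip: UNIV_Plus_UNIV)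

lemma hcat_nth [simp]: "(M ||| N) $ i $ Inl j = M $ i $ j" "(M ||| N) $ i $ Inr k = N $ i $ k"
  by (simp_all add: hcat_def)

lemma vcat_nth [simp]: "(M /// N) $ Inl i = M $ i" "(M /// N) $ Inr k = N $ k"
  by (simp_all add: vcat_def)

lemma hcat_eq_iff: "M ||| N = P ||| Q \<longleftrightarrow> M = P \<and> N = Q"
  by (auto simp: vec_eq_iff split_sum_all)

lemma vcat_eq_iff: "M /// N = P /// Q \<longleftrightarrow> M = P \<and> N = Q"
  by (auto simp: vec_eq_iff split_sum_all)

lemma hcat_exhaust: obtains M N where "X = M ||| N"
proof
  show "X = (\<chi> i j. X $ i $ Inl j) ||| (\<chi> i j. X $ i $ Inr j)"
    by (simp add: vec_eq_iff split_sum_all)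
qed

lemma vcat_exhaust: obtains M N where "X = M /// N"
proof
  show "X = (\<chi> i. X $ Inl i) /// (\<chi> i. X $ Inr i)"
    by (simp add: vec_eq_iff split_sum_all)
qed

lemma block_mult:
  shows hcat_vcat_mult: "(M ||| N) ** (P /// Q) = M ** P + N ** Q"
    and mult_hcat: "X ** (P' ||| Q') = X ** P' ||| X ** Q'"
    and vcat_mult: "(M' /// N') ** X = M' ** X /// N' ** X"
  by (simp_all add: vec_eq_iff split_sum_all matrix_matrix_mult_def sum_UNIV_sum_type)

lemma block_add:
  shows hcat_add: "(M ||| N) + (P ||| Q) = M + P ||| N + Q"
    and vcat_add: "(M' /// N') + (P' /// Q') = M' + P' /// N' + Q'"
  by (simp_all add: vec_eq_iff split_sum_all)

lemma block_diff:
  shows hcat_diff: "(M ||| N) - (P ||| Q) = M - P ||| N - Q"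
    and vcat_diff: "(M' /// N') - (P' /// Q') = M' - P' /// N' - Q'"
  by (simp_all add: vec_eq_iff split_sum_all)

lemma mat_block:
  "mat a = (mat a ||| 0 ||| 0) /// (0 ||| mat a ||| 0) /// (0 ||| 0 ||| mat a)"
  by (simp add: vec_eq_iff split_sum_all mat_def)

lemma matrix_minus_mult:
  fixes M :: "'a::ring_1 ^ 'n ^ 'm"
  shows matrix_mult_minus_left: "(- M) ** N = - (M ** N)"
    and matrix_mult_minus_right: "M ** (- N) = - (M ** N)"
    and matrix_diff_rdistrib: "(M - M') ** N = M ** N - M' ** N"
    and matrix_diff_ldistrib: "M ** (N - N') = M ** N - M ** N'"
    and matrix_add_rdistrib: "(M + M') ** N = M ** N + M' ** N"
    and matrix_mult_0_left: "0 ** N = (0 :: 'a ^ 'k ^ 'm)"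
    and matrix_mult_0_right: "M ** 0 = (0 :: 'a ^ 'k ^ 'm)"
  by (simp_all add: vec_eq_iff matrix_matrix_mult_def sum_negf sum_subtractf sum.distrib algebra_simps)

lemmas matrix_ring_simps =
  matrix_minus_mult matrix_add_ldistrib matrix_mul_assoc[symmetric]

section \<open>The nominal closed loop\<close>

lemma one_minus_closed_loop:
  "mat 1 - closed_loop A B C D K =
    (mat z_var - A ||| - B   ||| 0) ///
    (0             ||| mat 1 ||| - K) ///
    (- C           ||| - D   ||| mat 1)"
  unfolding closed_loop_def
  by (simp add: mat_block[of 1] block_diff hcat_eq_iff vcat_eq_iff)
    (simp add: vec_eq_iff mat_def)

lemma closed_loop_add_uncertainty:
  "closed_loop (A + \<Delta>A) (B + \<Delta>B) (C + \<Delta>C) (D + \<Delta>D) K =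
    closed_loop A B C D K + uncertainty \<Delta>A \<Delta>B \<Delta>C \<Delta>D"
  by (simp add: closed_loop_def uncertainty_def block_add hcat_eq_iff vcat_eq_iff)

text \<open>
  The columns of the inverse are the responses of state, control and measurement to disturbances
  of each of them, and the equations say that these responses obey the loop equations.
\<close>

lemma right_inverse_closed_loop_iff:
  "(mat 1 - closed_loop A B C D K) **
     ((Sxx ||| Sxu ||| Sxy) /// (Sux ||| Suu ||| Suy) /// (Syx ||| Syu ||| Syy)) = mat 1 \<longleftrightarrow>
   (mat z_var - A) ** Sxx - B ** Sux = mat 1 \<and>
   (mat z_var - A) ** Sxu - B ** Suu = 0 \<and>
   (mat z_var - A) ** Sxy - B ** Suy = 0 \<and>
   Sux = K ** Syx \<and> Suu = mat 1 + K ** Syu \<and> Suy = K ** Syy \<and>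
   Syx = C ** Sxx + D ** Sux \<and> Syu = C ** Sxu + D ** Suu \<and> Syy = mat 1 + C ** Sxy + D ** Suy"
  unfolding one_minus_closed_loop
  by (simp add: mat_block[of 1] block_mult block_add hcat_eq_iff vcat_eq_iff
      matrix_mult_0_left matrix_mult_minus_left)
    (auto simp: algebra_simps eq_neg_iff_add_eq_0)

lemma left_inverse_closed_loopD:
  assumes "((Sxx ||| Sxu ||| Sxy) /// (Sux ||| Suu ||| Suy) /// (Syx ||| Syu ||| Syy)) **
    (mat 1 - closed_loop A B C D K) = mat 1"
  shows "Sxx ** (mat z_var - A) - Sxy ** C = mat 1"
    and "Sux ** (mat z_var - A) - Suy ** C = 0"
  using assms
  unfolding one_minus_closed_loop
  by (auto simp: mat_block[of 1] block_mult block_add hcat_eq_iff vcat_eq_iff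
      matrix_mult_0_right matrix_mult_minus_right)

text \<open>
  \<open>K0\<close> is the \<open>uy\<close> entry of the Schur complement of \<open>Sxx\<close> in the inverse of the loop.  Eliminating
  the state leaves the loop of \<open>K\<close> with the direct feedthrough \<open>D\<close>, in which this entry is
  \<open>K (I - D K)\<^sup>-\<^sup>1\<close>; the fixed-point form avoids the inverse.
\<close>

lemma nominal_controller_fixed_point:
  assumes u: "Sux = K ** Syx" "Suy = K ** Syy"
    and y: "Syx = C ** Sxx + D ** Sux" "Syy = mat 1 + C ** Sxy + D ** Suy"
    and inv: "invertible Sxx"
  defines "K0 \<equiv> nominal_controller Sxx Sux Sxy Suy"
  shows "K0 = K ** (mat 1 + D ** K0)"
proof -
  let ?X = "matrix_inv Sxx"
  have "Sxx ** (?X ** Sxy) = Sxy"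
    by (simp add: matrix_mul_assoc matrix_inv_right[OF inv])
  then have "Syy - Syx ** (?X ** Sxy) = mat 1 + D ** K0"
    by (simp add: y K0_def nominal_controller_def matrix_ring_simps)
  then have "K ** (mat 1 + D ** K0) = K ** Syy - K ** Syx ** (?X ** Sxy)"
    by (metis matrix_diff_ldistrib matrix_mul_assoc)
  also have "\<dots> = K0"
    by (simp add: K0_def nominal_controller_def u matrix_mul_assoc)
  finally show ?thesis ..
qed

text \<open>
  The four maps determine the whole inverse: a disturbance of the control enters the loop only
  through \<open>B\<close> and \<open>D\<close>, so it acts like a disturbance of state and measurement, and the
  measurement row is the output equation.  What remains is that the control row obeys
  \<open>u = K y\<close>, and this comes from the second pair of constraints.
\<close>

lemma closed_loop_inverse_from_maps:
  assumes xx: "(mat z_var - A) ** \<Phi>xx - B ** \<Phi>ux = mat 1"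
    and xy: "(mat z_var - A) ** \<Phi>xy - B ** \<Phi>uy = 0"
    and xx': "\<Phi>xx ** (mat z_var - A) - \<Phi>xy ** C = mat 1"
    and ux': "\<Phi>ux ** (mat z_var - A) - \<Phi>uy ** C = 0"
    and inv: "invertible \<Phi>xx"
  defines "K0 \<equiv> nominal_controller \<Phi>xx \<Phi>ux \<Phi>xy \<Phi>uy"
  assumes M: "invertible (mat 1 + D ** K0)"
    and K: "K = K0 ** matrix_inv (mat 1 + D ** K0)"
  defines "Sxu \<equiv> \<Phi>xx ** B + \<Phi>xy ** D"
    and "Suu \<equiv> mat 1 + \<Phi>ux ** B + \<Phi>uy ** D"
  shows "(mat 1 - closed_loop A B C D K) **
     ((\<Phi>xx ||| Sxu ||| \<Phi>xy) /// (\<Phi>ux ||| Suu ||| \<Phi>uy) ///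
      (C ** \<Phi>xx + D ** \<Phi>ux ||| C ** Sxu + D ** Suu ||| mat 1 + C ** \<Phi>xy + D ** \<Phi>uy)) = mat 1"
proof -
  let ?X = "matrix_inv \<Phi>xx"
  \<comment> \<open>so \<open>K0 C x\<close> is the state feedback \<open>\<Phi>ux \<Phi>xx\<^sup>-\<^sup>1 x\<close>\<close>
  have K0C: "K0 ** C = \<Phi>ux ** ?X"
  proof -
    have "\<Phi>xy ** C = \<Phi>xx ** (mat z_var - A) - mat 1" and uyC: "\<Phi>uy ** C = \<Phi>ux ** (mat z_var - A)"
      using xx' ux' by (simp_all add: algebra_simps)
    then have "?X ** (\<Phi>xy ** C) = (mat z_var - A) - ?X"
      by (simp add: matrix_diff_ldistrib matrix_mul_assoc matrix_inv_left[OF inv])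
    then show ?thesis
      using uyC by (simp add: K0_def nominal_controller_def matrix_diff_rdistrib matrix_diff_ldistrib
          matrix_mul_assoc[symmetric])
  qed
  have ux: "K0 ** (C ** \<Phi>xx) = \<Phi>ux"
    using K0C by (simp add: matrix_mul_assoc) (simp add: matrix_mul_assoc[symmetric] matrix_inv_left[OF inv])
  have uy: "K0 ** (mat 1 + C ** \<Phi>xy) = \<Phi>uy"
    using K0C by (simp add: matrix_add_ldistrib matrix_mul_assoc) (simp add: K0_def nominal_controller_def)
  have K_eq: "K ** (Y + D ** (K0 ** Y)) = K0 ** Y" for Y :: "ratfun ^ 'z::finite ^ 'c"
  proof -
    have "Y + D ** (K0 ** Y) = (mat 1 + D ** K0) ** Y"
      by (simp add: matrix_ring_simps)
    then show ?thesis
      by (metis K M matrix_inv_left matrix_mul_assoc matrix_mul_rid)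
  qed
  have 1: "\<Phi>ux = K ** (C ** \<Phi>xx + D ** \<Phi>ux)"
    using K_eq[of "C ** \<Phi>xx"] by (simp add: ux)
  have 2: "\<Phi>uy = K ** (mat 1 + C ** \<Phi>xy + D ** \<Phi>uy)"
    using K_eq[of "mat 1 + C ** \<Phi>xy"] by (simp only: uy)
  have 3: "C ** Sxu + D ** Suu = (C ** \<Phi>xx + D ** \<Phi>ux) ** B + (mat 1 + C ** \<Phi>xy + D ** \<Phi>uy) ** D"
    by (simp add: Sxu_def Suu_def matrix_ring_simps algebra_simps)
  have 4: "Suu = mat 1 + K ** (C ** Sxu + D ** Suu)"
  proof -
    have "K ** (C ** Sxu + D ** Suu) =
        K ** (C ** \<Phi>xx + D ** \<Phi>ux) ** B + K ** (mat 1 + C ** \<Phi>xy + D ** \<Phi>uy) ** D"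
      unfolding 3 by (simp only: matrix_add_ldistrib[of K] matrix_mul_assoc)
    then show ?thesis
      unfolding 1[symmetric] 2[symmetric] by (simp add: Suu_def)
  qed
  have "(mat z_var - A) ** Sxu - B ** Suu =
      ((mat z_var - A) ** \<Phi>xx - B ** \<Phi>ux) ** B + ((mat z_var - A) ** \<Phi>xy - B ** \<Phi>uy) ** D - B"
    by (simp add: Sxu_def Suu_def matrix_ring_simps algebra_simps)
  then have 5: "(mat z_var - A) ** Sxu - B ** Suu = 0"
    by (simp add: xx xy matrix_mult_0_left)
  show ?thesis
    unfolding right_inverse_closed_loop_iff using 1 2 4 5 xx xy by simp
qed

lemma mat_mult_component: "(mat a ** F) $ i $ j = a * F $ i $ j"
  and mult_mat_component: "(F' ** mat a) $ i $ j = F' $ i $ j * a"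
  for a :: "'a::comm_semiring_1"
  by (simp_all add: matrix_matrix_mult_def mat_def if_distrib[where f="\<lambda>x. x * _"]
      if_distrib[where f="\<lambda>x. _ * x"] cong: if_cong)

lemma mat_mult_commute: "mat a ** F = F ** mat a" for a :: "'a::comm_semiring_1"
  by (simp add: vec_eq_iff mat_mult_component mult_mat_component mult.commute)

text \<open>
  Strict properness as membership of \<open>z F\<close> in the ring of stable proper matrices: the loop
  equations give \<open>z F\<close> as a polynomial expression in stable proper matrices.
\<close>

lemma zinv_RH_inf_iff: "F \<in> zinv_RH_inf \<longleftrightarrow> mat z_var ** F \<in> RH_inf"
proof
  assume "F \<in> zinv_RH_inf"
  then obtain G where G: "F = map_matrix (\<lambda>f. \<zeta> * f) G" "G \<in> RH_inf"
    by (auto simp: zinv_RH_inf_def)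
  then have "mat z_var ** F = G"
    using z_var_nonzero by (simp add: vec_eq_iff mat_mult_component)
  then show "mat z_var ** F \<in> RH_inf"
    using G by simp
next
  assume "mat z_var ** F \<in> RH_inf"
  moreover have "F = map_matrix (\<lambda>f. \<zeta> * f) (mat z_var ** F)"
    using z_var_nonzero by (simp add: vec_eq_iff mat_mult_component)
  ultimately show "F \<in> zinv_RH_inf"
    by (auto simp: zinv_RH_inf_def)
qed

lemma
  assumes "F \<in> zinv_RH_inf"
  shows zinv_RH_inf_subset_RH_inf: "F \<in> RH_inf"
    and zinv_RH_inf_mat_at_0: "mat_at F 0 = 0"
proof -
  obtain G where G: "F = map_matrix (\<lambda>f. \<zeta> * f) G" "G \<in> RH_inf"
    using assms by (auto simp: zinv_RH_inf_def)
  show "F \<in> RH_inf"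
    using G RH_infD[OF G(2)] by (auto simp: RH_inf_iff mat_regular_at_def regular_at_mult)
  show "mat_at F 0 = 0"
    using G RH_infD[OF G(2), of 0] by (simp add: vec_eq_iff value_at_mult mat_regular_at_def)
qed

text \<open>
  \<open>G = z \<Phi>xx = I + A \<Phi>xx + B \<Phi>ux\<close> has the value \<open>I\<close> at infinity because \<open>\<Phi>xx\<close> and
  \<open>\<Phi>ux\<close> are strictly proper.  So \<open>G\<close> has a proper inverse; the factor \<open>z\<close> in
  \<open>\<Phi>xx\<^sup>-\<^sup>1 = z G\<^sup>-\<^sup>1\<close> is absorbed by the strictly proper \<open>\<Phi>xy\<close>.
\<close>

lemma
  fixes A :: "real ^ 'n::finite ^ 'n" and B :: "real ^ 'm::finite ^ 'n"
  assumes xx: "(mat z_var - const_tf A) ** \<Phi>xx - const_tf B ** \<Phi>ux = mat 1"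
    and strict: "\<Phi>xx \<in> zinv_RH_inf" "\<Phi>ux \<in> zinv_RH_inf" 
  shows invertible_state_map: "invertible \<Phi>xx"
    and nominal_controller_proper:
      "\<Phi>xy \<in> zinv_RH_inf \<Longrightarrow> \<Phi>uy \<in> RH_inf \<Longrightarrow> tf_proper (nominal_controller \<Phi>xx \<Phi>ux \<Phi>xy \<Phi>uy)"
proof -
  define G where "G = mat z_var ** \<Phi>xx"
  have G: "G = mat 1 + const_tf A ** \<Phi>xx + const_tf B ** \<Phi>ux"
    using xx by (simp add: G_def matrix_diff_rdistrib algebra_simps)
  have reg: "mat_regular_at \<Phi>xx 0" "mat_regular_at \<Phi>ux 0"
    using strict by (auto intro: RH_infD zinv_RH_inf_subset_RH_inf)
  have Greg: "mat_regular_at G 0" and "mat_at G 0 = mat 1"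
    unfolding G using strict reg
    by (simp_all add: mat_regular_at_add mat_at_add mat_regular_at_mult mat_at_mult zinv_RH_inf_mat_at_0
        matrix_mult_0_right)
  then have det: "det (mat_at G 0) \<noteq> 0"
    by simp
  have invG: "invertible G" and regG: "mat_regular_at (matrix_inv G) 0"
    using invertible_if_value_nonsingular[OF Greg det] mat_regular_at_matrix_inv[OF Greg det] .
  have inv: "\<Phi>xx ** (mat z_var ** matrix_inv G) = mat 1"
    using matrix_inv_right[OF invG]
    by (simp add: G_def matrix_mul_assoc mat_mult_commute[of z_var \<Phi>xx])
  then show "invertible \<Phi>xx"
    by (rule invertibleI_right)
  have X: "matrix_inv \<Phi>xx = mat z_var ** matrix_inv G"
    using inv by (rule matrix_inv_eqI)
  assume xy: "\<Phi>xy \<in> zinv_RH_inf" and uy: "\<Phi>uy \<in> RH_inf"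
  have "nominal_controller \<Phi>xx \<Phi>ux \<Phi>xy \<Phi>uy =
      \<Phi>uy - \<Phi>ux ** (matrix_inv G ** (mat z_var ** \<Phi>xy))"
    by (simp add: nominal_controller_def X matrix_mul_assoc mat_mult_commute[of z_var "\<Phi>xy"])
      (simp add: matrix_mul_assoc[symmetric] mat_mult_commute[of z_var])
  then show "tf_proper (nominal_controller \<Phi>xx \<Phi>ux \<Phi>xy \<Phi>uy)"
    using xy uy reg regG
    by (simp add: tf_proper_iff mat_regular_at_diff mat_regular_at_mult RH_infD zinv_RH_inf_iff)
qed

section \<open>The small-gain condition is sufficient\<close>

text \<open>
  An uncertainty reads only the state and control components of a signal and writes only to the
  state and measurement components.
\<close>

definition proj_xu :: "'a ^ ('n::finite + 'm::finite + 'p::finite) \<Rightarrow> 'a ^ ('n + 'm)"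
  where "proj_xu v = (\<chi> i. case i of Inl j \<Rightarrow> v $ Inl j | Inr k \<Rightarrow> v $ Inr (Inl k))"

definition embed_xu :: "'a::zero ^ ('n::finite + 'm::finite) \<Rightarrow> 'a ^ ('n + 'm + 'p::finite)"
  where "embed_xu v = (\<chi> i. case i of Inl j \<Rightarrow> v $ Inl j | Inr (Inl k) \<Rightarrow> v $ Inr k | Inr (Inr l) \<Rightarrow> 0)"

definition proj_xy :: "'a ^ ('n::finite + 'm::finite + 'p::finite) \<Rightarrow> 'a ^ ('n + 'p)"
  where "proj_xy v = (\<chi> i. case i of Inl j \<Rightarrow> v $ Inl j | Inr l \<Rightarrow> v $ Inr (Inr l))"

definition embed_xy :: "'a::zero ^ ('n::finite + 'p::finite) \<Rightarrow> 'a ^ ('n + 'm::finite + 'p)"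
  where "embed_xy v = (\<chi> i. case i of Inl j \<Rightarrow> v $ Inl j | Inr (Inl k) \<Rightarrow> 0 | Inr (Inr l) \<Rightarrow> v $ Inr l)"

lemmas channel_defs = proj_xu_def embed_xu_def proj_xy_def embed_xy_def

lemma norm_vec_sum_type:
  "(norm v)\<^sup>2 = (\<Sum>i\<in>UNIV. (norm (v $ Inl i))\<^sup>2) + (\<Sum>i\<in>UNIV. (norm (v $ Inr i))\<^sup>2)"
  for v :: "complex ^ ('a::finite + 'b::finite)"
  by (simp add: norm_vec_def L2_set_def sum_nonneg sum_UNIV_sum_type)

lemma norm_embed_xy: "norm (embed_xy v :: complex ^ ('n::finite + 'm::finite + 'p::finite)) = norm v"
proof -
  have "(norm (embed_xy v :: complex ^ ('n + 'm + 'p)))\<^sup>2 = (norm v)\<^sup>2"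
    unfolding norm_vec_sum_type by (simp add: channel_defs sum_UNIV_sum_type)
  then show ?thesis by simp
qed

lemma norm_embed_xu: "norm (embed_xu v :: complex ^ ('n::finite + 'm::finite + 'p::finite)) = norm v"
proof -
  have "(norm (embed_xu v :: complex ^ ('n + 'm + 'p)))\<^sup>2 = (norm v)\<^sup>2"
    unfolding norm_vec_sum_type by (simp add: channel_defs sum_UNIV_sum_type)
  then show ?thesis by simp
qed

lemma norm_proj_xu: "norm (proj_xu v) \<le> norm v"
  for v :: "complex ^ ('n::finite + 'm::finite + 'p::finite)"
proof (rule power2_le_imp_le)
  show "(norm (proj_xu v))\<^sup>2 \<le> (norm v)\<^sup>2"
    unfolding norm_vec_sum_type by (simp add: channel_defs sum_UNIV_sum_type sum_nonneg)
qed simp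

lemma norm_proj_xy: "norm (proj_xy v) \<le> norm v"
  for v :: "complex ^ ('n::finite + 'm::finite + 'p::finite)"
proof (rule power2_le_imp_le)
  show "(norm (proj_xy v))\<^sup>2 \<le> (norm v)\<^sup>2"
    unfolding norm_vec_sum_type by (simp add: channel_defs sum_UNIV_sum_type sum_nonneg)
qed simp

lemma mat_regular_at_hcat: "mat_regular_at (M ||| N) w \<longleftrightarrow> mat_regular_at M w \<and> mat_regular_at N w"
  by (auto simp: mat_regular_at_def split_sum_all)

lemma mat_regular_at_vcat: "mat_regular_at (M /// N) w \<longleftrightarrow> mat_regular_at M w \<and> mat_regular_at N w"
  by (auto simp: mat_regular_at_def split_sum_all)

lemma RH_inf_hcat: "M ||| N \<in> RH_inf \<longleftrightarrow> M \<in> RH_inf \<and> N \<in> RH_inf"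
  and RH_inf_vcat: "P /// Q \<in> RH_inf \<longleftrightarrow> P \<in> RH_inf \<and> Q \<in> RH_inf"
  by (auto simp: RH_inf_iff mat_regular_at_hcat mat_regular_at_vcat)

lemma RH_inf_uncertainty:
  "uncertainty \<Delta>A \<Delta>B \<Delta>C \<Delta>D \<in> RH_inf \<longleftrightarrow> \<Delta>A \<in> RH_inf \<and> \<Delta>B \<in> RH_inf \<and> \<Delta>C \<in> RH_inf \<and> \<Delta>D \<in> RH_inf"
  by (auto simp: uncertainty_def RH_inf_hcat RH_inf_vcat RH_inf_0)

lemma uncertainty_in_set_iff:
  "uncertainty \<Delta>A \<Delta>B \<Delta>C \<Delta>D \<in> uncertainty_set \<epsilon> \<longleftrightarrow>
    uncertainty \<Delta>A \<Delta>B \<Delta>C \<Delta>D \<in> RH_inf \<and> Hinf_norm (uncertainty \<Delta>A \<Delta>B \<Delta>C \<Delta>D) < \<epsilon>"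
  unfolding uncertainty_set_def RH_inf_uncertainty
  by (auto simp: uncertainty_def hcat_eq_iff vcat_eq_iff)

lemma mat_at_uncertainty_factor:
  fixes v :: "complex ^ ('n::finite + 'm::finite + 'p::finite)"
  assumes "\<Delta> = uncertainty \<Delta>A \<Delta>B \<Delta>C \<Delta>D"
  shows "mat_at \<Delta> w *v embed_xu (proj_xu v) = mat_at \<Delta> w *v v"
    and "embed_xy (proj_xy (mat_at \<Delta> w *v v)) = mat_at \<Delta> w *v v"
  by (simp_all add: assms uncertainty_def vec_eq_iff split_sum_all matrix_vector_mult_def
      sum_UNIV_sum_type channel_defs)

text \<open>
  What an uncertainty writes returns to what it reads through the four maps alone; this is why only
  their norm enters the robustness condition.
\<close>

lemma proj_mat_at_embed:
  fixes Sxx :: "('n::finite, 'n) tfmat" and Suu :: "('m::finite, 'm) tfmat"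
    and Syy :: "('p::finite, 'p) tfmat"
  shows "proj_xu (mat_at ((Sxx ||| Sxu ||| Sxy) /// (Sux ||| Suu ||| Suy) /// (Syx ||| Syu ||| Syy)) w *v
      embed_xy g) = mat_at ((Sxx ||| Sxy) /// (Sux ||| Suy)) w *v g"
  by (simp add: vec_eq_iff split_sum_all matrix_vector_mult_def sum_UNIV_sum_type channel_defs)

text \<open>
  If \<open>v = S \<Delta> v\<close> at a point of the disc, then the part \<open>x\<close> of \<open>v\<close> that \<open>\<Delta>\<close> reads and
  the part \<open>g\<close> of \<open>\<Delta> v\<close> that it writes satisfy \<open>x = \<Phi> g\<close>, hence
  \<open>|x| \<le> \<parallel>\<Phi>\<parallel> \<parallel>\<Delta>\<parallel> |x|\<close> with a factor less than 1.  So \<open>I - S \<Delta>\<close> is nonsingular on the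
  disc and Cramer's rule applies.
\<close>

lemma small_gain:
  fixes Sxx :: "('n::finite, 'n) tfmat" and Suu :: "('m::finite, 'm) tfmat"
    and Syy :: "('p::finite, 'p) tfmat"
  assumes S_def: "S = (Sxx ||| Sxu ||| Sxy) /// (Sux ||| Suu ||| Suy) /// (Syx ||| Syu ||| Syy)"
    and \<Phi>_def: "\<Phi> = (Sxx ||| Sxy) /// (Sux ||| Suy)"
    and S: "S \<in> RH_inf" and \<epsilon>: "\<epsilon> > 0"
    and \<Phi>: "Hinf_norm \<Phi> \<le> inverse \<epsilon>"
    and \<Delta>: "\<Delta> \<in> RH_inf" "\<Delta> = uncertainty \<Delta>A \<Delta>B \<Delta>C \<Delta>D" "Hinf_norm \<Delta> < \<epsilon>"
  shows "invertible (mat 1 - S ** \<Delta>)" and "matrix_inv (mat 1 - S ** \<Delta>) \<in> RH_inf"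
proof -
  have RH: "mat 1 - S ** \<Delta> \<in> RH_inf"
    using S \<Delta> by (intro RH_inf_diff RH_inf_mult RH_inf_mat_1)
  have \<Phi>_RH: "\<Phi> \<in> RH_inf"
    using S by (simp add: S_def \<Phi>_def RH_inf_vcat RH_inf_hcat)
  have nonsing: "v = 0" if w: "cmod w \<le> 1" and v: "mat_at (mat 1 - S ** \<Delta>) w *v v = 0" for w v
  proof -
    note reg = RH_infD[OF S w] RH_infD[OF \<Delta>(1) w]
    define x where "x = proj_xu v"
    define g where "g = proj_xy (mat_at \<Delta> w *v v)"
    have \<Delta>v: "mat_at \<Delta> w *v v = embed_xy g"
      using mat_at_uncertainty_factor(2)[OF \<Delta>(2)] by (simp add: g_def)
    have v_eq: "v = mat_at S w *v embed_xy g"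
      using v reg by (simp add: mat_at_diff mat_at_mult mat_regular_at_mult matrix_vector_mult_diff_rdistrib
          \<Delta>v flip: matrix_vector_mul_assoc)
    then have "x = mat_at \<Phi> w *v g"
      unfolding x_def S_def \<Phi>_def by (metis proj_mat_at_embed)
    then have "norm x \<le> inverse \<epsilon> * norm g"
      using Hinf_norm_bounds_disc[OF \<Phi>_RH w, of g] \<Phi>
      by (metis mult_right_mono norm_ge_zero order_trans)
    moreover have "norm g \<le> Hinf_norm \<Delta> * norm x"
    proof -
      have "norm g \<le> norm (mat_at \<Delta> w *v v)"
        unfolding g_def by (rule norm_proj_xy)
      also have "\<dots> = norm (mat_at \<Delta> w *v embed_xu x)"
        using mat_at_uncertainty_factor(1)[OF \<Delta>(2)] by (simp add: x_def)
      also have "\<dots> \<le> Hinf_norm \<Delta> * norm (embed_xu x :: complex ^ ('n + 'm + 'p))"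
        by (rule Hinf_norm_bounds_disc[OF \<Delta>(1) w])
      finally show ?thesis
        by (simp add: norm_embed_xu)
    qed
    ultimately have "\<epsilon> * norm x \<le> Hinf_norm \<Delta> * norm x"
      using \<epsilon> by (simp add: field_simps)
    then have "x = 0"
      using \<Delta>(3) by (simp add: mult_le_cancel_right)
    then have "g = 0"
      using \<open>norm g \<le> Hinf_norm \<Delta> * norm x\<close> by simp
    then show "v = 0"
      using v_eq by (simp add: embed_xy_def vec_eq_iff matrix_vector_mult_def split: sum.split)
  qed
  show "invertible (mat 1 - S ** \<Delta>)"
    by (rule matrix_inv_in_RH_inf(1)[OF RH]) (fact nonsing)
  show "matrix_inv (mat 1 - S ** \<Delta>) \<in> RH_inf"
    by (rule matrix_inv_in_RH_inf(2)[OF RH]) (fact nonsing)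
qed

section \<open>The small-gain condition is necessary\<close>

text \<open>
  The first-order all-pass function \<open>(x - q) / (1 - q x)\<close> with real \<open>q\<close> takes the value \<open>c\<close> at
  \<open>w\<close> for \<open>q = (c - w) / (c w - 1)\<close>.  This \<open>q\<close> is real because \<open>c\<close> and \<open>w\<close> lie on the
  unit circle, and \<open>|c w - 1|\<^sup>2 - |c - w|\<^sup>2 = 4 Im c Im w\<close> shows that \<open>|q| < 1\<close> exactly under
  the sign condition.
\<close>

lemma blaschke_interpolation:
  assumes c: "cmod c = 1" and w: "cmod w = 1" and pos: "Im c * Im w > 0"
  obtains f where "\<And>x. cmod x \<le> 1 \<Longrightarrow> regular_at f x" "value_at f w = c"
    "\<And>x. cmod x = 1 \<Longrightarrow> cmod (value_at f x) = 1"
proof -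
  define q where "q = (c - w) / (c * w - 1)"
  have sq: "Re c * Re c + Im c * Im c = 1" "Re w * Re w + Im w * Im w = 1"
    using c w by (simp_all add: cmod_def power2_eq_square)
  \<comment> \<open>for unit \<open>c\<close> and \<open>w\<close> the two squares are \<open>2 - 2 Re (c w)\<close> and \<open>2 - 2 Re (c cnj w)\<close>\<close>
  have dist: "(cmod (c * w - 1))\<^sup>2 = (cmod (c - w))\<^sup>2 + 4 * (Im c * Im w)"
  proof -
    have "(cmod (c * w - 1))\<^sup>2 = (Re c * Re c + Im c * Im c) * (Re w * Re w + Im w * Im w) + 1
      - 2 * (Re c * Re w - Im c * Im w)"
      unfolding cmod_power2 by (simp add: power2_eq_square algebra_simps)
    moreover have "(cmod (c - w))\<^sup>2 = (Re c * Re c + Im c * Im c) + (Re w * Re w + Im w * Im w)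
      - 2 * (Re c * Re w + Im c * Im w)"
      unfolding cmod_power2 by (simp add: power2_eq_square algebra_simps)
    ultimately show ?thesis
      by (simp add: sq)
  qed
  have lt: "cmod (c - w) < cmod (c * w - 1)"
  proof (rule power_less_imp_less_base)
    show "(cmod (c - w))\<^sup>2 < (cmod (c * w - 1))\<^sup>2"
      unfolding dist using pos by linarith
  qed simp
  then have nz: "c * w \<noteq> 1"
    by auto
  have "c \<noteq> 0" "w \<noteq> 0" using c w by auto
  have "cnj q = q"
  proof -
    have "cnj c = inverse c" "cnj w = inverse w"
      using complex_norm_square[of c] complex_norm_square[of w] c w
      by (simp_all add: inverse_unique)
    then have "cnj q = (inverse c - inverse w) / (inverse c * inverse w - 1)"
      by (simp add: q_def)
    also have "\<dots> = (c * w * (inverse c - inverse w)) / (c * w * (inverse c * inverse w - 1))"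
      using \<open>c \<noteq> 0\<close> \<open>w \<noteq> 0\<close> by simp
    also have "c * w * (inverse c - inverse w) = - (c - w)"
      using \<open>c \<noteq> 0\<close> \<open>w \<noteq> 0\<close> by (simp add: field_simps)
    also have "c * w * (inverse c * inverse w - 1) = - (c * w - 1)"
      using \<open>c \<noteq> 0\<close> \<open>w \<noteq> 0\<close> by (simp add: field_simps)
    also have "- (c - w) / - (c * w - 1) = q"
      by (simp only: q_def minus_divide_divide)
    finally show ?thesis .
  qed
  then obtain a where a: "q = complex_of_real a"
    unfolding Reals_cnj_iff[symmetric] by (rule Reals_cases)
  have a1: "\<bar>a\<bar> < 1"
  proof -
    have "cmod q < 1"
      using lt by (simp add: q_def norm_divide divide_less_eq_1)
    then show ?thesis by (simp add: a)
  qed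
  define f where "f = (\<zeta> - const_rf a) * inverse (1 - const_rf a * \<zeta>)"
  have den: "1 - complex_of_real a * x \<noteq> 0" if "cmod x \<le> 1" for x
  proof
    assume "1 - complex_of_real a * x = 0"
    then have "\<bar>a\<bar> * cmod x = 1"
      by (metis eq_iff_diff_eq_0 norm_mult norm_of_real norm_one)
    moreover have "\<bar>a\<bar> * cmod x \<le> \<bar>a\<bar> * 1"
      using that by (intro mult_left_mono) auto
    ultimately show False using a1 by simp
  qed
  have den_reg: "regular_at (1 - const_rf a * \<zeta>) x"
    "value_at (1 - const_rf a * \<zeta>) x = 1 - complex_of_real a * x" for x
    by (simp_all add: regular_at_diff regular_at_mult value_at_diff value_at_mult)
  have num_reg: "regular_at (\<zeta> - const_rf a) x"
    "value_at (\<zeta> - const_rf a) x = x - complex_of_real a" for x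
    by (simp_all add: regular_at_diff value_at_diff)
  have reg: "regular_at f x"
    and val: "value_at f x = (x - complex_of_real a) / (1 - complex_of_real a * x)" if "cmod x \<le> 1" for x
    unfolding f_def using den[OF that]
    by (simp_all add: den_reg num_reg regular_at_mult value_at_mult regular_at_inverse value_at_inverse divide_inverse)
  show ?thesis
  proof (rule that[OF reg])
    have "q * (c * w - 1) = c - w"
      using nz by (simp add: q_def)
    then have "w - q = c * (1 - q * w)"
      by (simp add: algebra_simps)
    then show "value_at f w = c"
      using w den[of w] by (simp add: val a)
    fix x :: complex assume x: "cmod x = 1"
    \<comment> \<open>on the unit circle, multiplying the conjugate of the numerator by \<open>x\<close> gives the denominator\<close>
    have "cmod (x - complex_of_real a) = cmod (cnj x - complex_of_real a)"
      by (metis complex_cnj_complex_of_real complex_cnj_diff complex_mod_cnj)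
    also have "\<dots> = cmod (x * (cnj x - complex_of_real a))"
      using x by (simp add: norm_mult)
    also have "x * (cnj x - complex_of_real a) = 1 - complex_of_real a * x"
      using x by (simp add: right_diff_distrib complex_norm_square[symmetric] mult.commute)
    finally show "cmod (value_at f x) = 1"
      using x den[of x] by (simp add: val norm_divide)
  qed
qed

text \<open>
  At a real point the value of a real rational function is real, hence the condition on
  \<open>Im w\<close>.  The sign of the scaling factor is chosen so that the all-pass function has to
  interpolate a value on the side of the real axis where this is possible.
\<close>

lemma interpolation_constant_modulus:
  assumes w: "cmod w = 1" "Im w \<noteq> 0"
  obtains f where "\<And>x. cmod x \<le> 1 \<Longrightarrow> regular_at f x" "value_at f w = b"
    "\<And>x. cmod x = 1 \<Longrightarrow> cmod (value_at f x) = cmod b"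
proof -
  have "\<exists>r c f. b = complex_of_real r * c \<and> \<bar>r\<bar> = cmod b \<and> (\<forall>x. cmod x \<le> 1 \<longrightarrow> regular_at f x) \<and>
    value_at f w = c \<and> (\<forall>x. cmod x = 1 \<longrightarrow> cmod (value_at f x) = 1)"
  proof (cases "Im b = 0")
    case True
    then have "b = complex_of_real (Re b) * 1" "\<bar>Re b\<bar> = cmod b"
      by (simp_all add: complex_eq_iff cmod_def)
    moreover have "(\<forall>x. cmod x \<le> 1 \<longrightarrow> regular_at 1 x) \<and> value_at 1 w = 1 \<and>
        (\<forall>x. cmod x = 1 \<longrightarrow> cmod (value_at 1 x) = 1)"
      by simp
    ultimately show ?thesis by blast
  next
    case False
    define r where "r = (if Im b * Im w > 0 then cmod b else - cmod b)"
    have "b \<noteq> 0" using False by auto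
    have r: "\<bar>r\<bar> = cmod b"
      by (simp add: r_def)
    then have "r \<noteq> 0"
      using \<open>b \<noteq> 0\<close> by auto
    define c where "c = b / complex_of_real r"
    have "cmod c = 1"
      using r \<open>b \<noteq> 0\<close> by (simp add: c_def norm_divide)
    moreover have "Im c * Im w > 0"
    proof -
      have eq: "Im c * Im w = (Im b * Im w) / r"
        by (simp add: c_def Im_divide_of_real)
      have "Im b * Im w \<noteq> 0"
        using False w by simp
      then consider "Im b * Im w > 0" | "Im b * Im w < 0"
        by linarith
      then show ?thesis
        unfolding eq using \<open>b \<noteq> 0\<close>
        by cases (simp_all add: r_def divide_neg_pos)
    qed
    ultimately obtain f where "\<And>x. cmod x \<le> 1 \<Longrightarrow> regular_at f x" "value_at f w = c"
        "\<And>x. cmod x = 1 \<Longrightarrow> cmod (value_at f x) = 1"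
      using w(1) by (metis blaschke_interpolation)
    moreover have "b = complex_of_real r * c"
      using \<open>r \<noteq> 0\<close> by (simp add: c_def)
    ultimately show ?thesis
      using r by blast
  qed
  then obtain r c f where *: "b = complex_of_real r * c" "\<bar>r\<bar> = cmod b"
    "\<And>x. cmod x \<le> 1 \<Longrightarrow> regular_at f x" "value_at f w = c"
    "\<And>x. cmod x = 1 \<Longrightarrow> cmod (value_at f x) = 1"
    by blast
  show ?thesis
    by (rule that[of "const_rf r * f"])
      (use * w in \<open>simp_all add: regular_at_mult value_at_mult norm_mult\<close>)
qed

lemma norm_vector_smult: "norm (c *s v) = cmod c * norm v" for v :: "complex ^ 'n::finite"
  by (simp add: norm_vec_def norm_mult L2_set_right_distrib)

lemma norm_sum_mult_le:
  fixes a v :: "complex ^ 'n::finite"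
  shows "cmod (\<Sum>i\<in>UNIV. a $ i * v $ i) \<le> norm a * norm v"
proof -
  have "cmod (\<Sum>i\<in>UNIV. a $ i * v $ i) \<le> (\<Sum>i\<in>UNIV. \<bar>cmod (a $ i)\<bar> * \<bar>cmod (v $ i)\<bar>)"
    by (rule order_trans[OF norm_sum]) (simp add: norm_mult)
  also have "\<dots> \<le> norm a * norm v"
    unfolding norm_vec_def by (rule L2_set_mult_ineq)
  finally show ?thesis .
qed

text \<open>
  At \<open>w\<close> the perturbation is to be the rank-one matrix \<open>b a\<^sup>* / |a|\<^sup>2\<close>, which maps \<open>a\<close> to
  \<open>b\<close> and has norm \<open>|b| / |a|\<close>.  Interpolating each component of \<open>b\<close> and of
  \<open>a\<^sup>* / |a|\<^sup>2\<close> by a stable function of constant modulus keeps that norm on the whole circle.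
\<close>

lemma rank_one_uncertainty:
  fixes a :: "complex ^ ('n::finite + 'm::finite)" and b :: "complex ^ ('n + 'p::finite)"
  assumes w: "cmod w = 1" "Im w \<noteq> 0" and ab: "norm b < \<epsilon> * norm a"
  obtains \<Delta>A \<Delta>B \<Delta>C \<Delta>D
  where "(uncertainty \<Delta>A \<Delta>B \<Delta>C \<Delta>D :: ('n + 'm + 'p, 'n + 'm + 'p) tfmat) \<in> uncertainty_set \<epsilon>"
    and "\<And>v. proj_xu v = a \<Longrightarrow> mat_at (uncertainty \<Delta>A \<Delta>B \<Delta>C \<Delta>D) w *v v = embed_xy b"
proof -
  have a: "a \<noteq> 0"
    using ab by auto
  define a' where "a' = (\<chi> j. cnj (a $ j) / complex_of_real ((norm a)\<^sup>2))"
  have a'a: "(\<Sum>j\<in>UNIV. a' $ j * a $ j) = 1"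
  proof -
    have "(\<Sum>j\<in>UNIV. a' $ j * a $ j) = (\<Sum>j\<in>UNIV. cnj (a $ j) * a $ j) / complex_of_real ((norm a)\<^sup>2)"
      by (simp add: a'_def sum_divide_distrib)
    also have "(\<Sum>j\<in>UNIV. cnj (a $ j) * a $ j) = complex_of_real ((norm a)\<^sup>2)"
    proof -
      have "(norm a)\<^sup>2 = (\<Sum>j\<in>UNIV. (cmod (a $ j))\<^sup>2)"
        by (simp add: norm_vec_def L2_set_def sum_nonneg)
      then show ?thesis
        by (simp only: of_real_sum complex_norm_square mult.commute[of "cnj _"])
    qed
    finally show ?thesis
      using a by simp
  qed
  have norm_a': "norm a' = inverse (norm a)"
  proof -
    have "a' = inverse (complex_of_real ((norm a)\<^sup>2)) *s (\<chi> j. cnj (a $ j))"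
      by (simp add: a'_def vec_eq_iff divide_inverse)
    moreover have "norm (\<chi> j. cnj (a $ j)) = norm a"
      by (simp add: norm_vec_def)
    ultimately show ?thesis
      using a by (simp add: norm_vector_smult norm_inverse norm_mult norm_power power2_eq_square)
  qed
  have "\<exists>f. (\<forall>x. cmod x \<le> 1 \<longrightarrow> regular_at f x) \<and> value_at f w = c \<and>
      (\<forall>x. cmod x = 1 \<longrightarrow> cmod (value_at f x) = cmod c)" for c
    by (rule interpolation_constant_modulus[OF w, of c]) blast
  then obtain F where F: "\<And>c x. cmod x \<le> 1 \<Longrightarrow> regular_at (F c) x" "\<And>c. value_at (F c) w = c"
    "\<And>c x. cmod x = 1 \<Longrightarrow> cmod (value_at (F c) x) = cmod c"
    by metis
  define \<beta> where "\<beta> i = F (b $ i)" for i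
  define \<alpha> where "\<alpha> j = F (a' $ j)" for j
  define \<Delta> :: "('n + 'm + 'p, 'n + 'm + 'p) tfmat"
    where "\<Delta> = uncertainty (\<chi> i j. \<beta> (Inl i) * \<alpha> (Inl j)) (\<chi> i j. \<beta> (Inl i) * \<alpha> (Inr j))
      (\<chi> i j. \<beta> (Inr i) * \<alpha> (Inl j)) (\<chi> i j. \<beta> (Inr i) * \<alpha> (Inr j))"
  have RH: "\<Delta> \<in> RH_inf"
    unfolding \<Delta>_def RH_inf_uncertainty
    by (auto simp: RH_inf_iff mat_regular_at_def \<alpha>_def \<beta>_def intro!: regular_at_mult F)
  have \<Delta>v: "mat_at \<Delta> x *v v =
      (\<Sum>j\<in>UNIV. (\<chi> j. value_at (\<alpha> j) x) $ j * proj_xu v $ j) *s embed_xy (\<chi> i. value_at (\<beta> i) x)"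
    if "cmod x = 1" for x v
  proof -
    have "value_at (\<beta> i * \<alpha> j) x = value_at (\<beta> i) x * value_at (\<alpha> j) x" for i j
      using that by (simp add: value_at_mult \<alpha>_def \<beta>_def F)
    then have "(mat_at \<Delta> x *v v) $ i = (\<Sum>j\<in>UNIV. value_at (\<alpha> j) x * proj_xu v $ j) *
        embed_xy (\<chi> i. value_at (\<beta> i) x) $ i" for i
      unfolding \<Delta>_def uncertainty_def matrix_vector_mult_def sum_UNIV_sum_type channel_defs
      by (simp split: sum.split) (simp add: distrib_left sum_distrib_left mult_ac)
    then show ?thesis
      by (simp add: vec_eq_iff)
  qed
  have "Hinf_norm \<Delta> \<le> inverse (norm a) * norm b"
  proof (rule Hinf_norm_leI)
    fix x v assume x: "cmod x = 1"
    let ?a = "\<chi> j. value_at (\<alpha> j) x" and ?b = "\<chi> i. value_at (\<beta> i) x"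
    have norms: "norm ?a = norm a'" "norm ?b = norm b"
      using x by (simp_all add: norm_vec_def \<alpha>_def \<beta>_def F)
    have "norm (mat_at \<Delta> x *v v) = cmod (\<Sum>j\<in>UNIV. ?a $ j * proj_xu v $ j) * norm ?b"
      unfolding \<Delta>v[OF x] norm_vector_smult norm_embed_xy ..
    also have "\<dots> \<le> (norm ?a * norm (proj_xu v)) * norm ?b"
      by (intro mult_right_mono norm_sum_mult_le norm_ge_zero)
    also have "\<dots> = (norm a' * norm (proj_xu v)) * norm b"
      unfolding norms ..
    also have "\<dots> \<le> (norm a' * norm v) * norm b"
      by (intro mult_right_mono mult_left_mono norm_proj_xu) auto
    finally show "norm (mat_at \<Delta> x *v v) \<le> inverse (norm a) * norm b * norm v"
      by (simp add: norm_a' mult_ac)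
  qed
  also have "\<dots> < \<epsilon>"
    using ab a by (simp add: field_simps)
  finally have "\<Delta> \<in> uncertainty_set \<epsilon>"
    using RH unfolding \<Delta>_def uncertainty_in_set_iff by simp
  moreover have "mat_at \<Delta> w *v v = embed_xy b" if "proj_xu v = a" for v
    using a'a by (simp add: \<Delta>v w that \<alpha>_def \<beta>_def F)
  ultimately show ?thesis
    unfolding \<Delta>_def by (rule that)
qed

text \<open>
  If \<open>|\<Phi> b| > |b| / \<epsilon>\<close> at some point of the circle, then by continuity also at a nonreal point
  \<open>w\<close>.  An admissible perturbation that maps \<open>a = \<Phi> b\<close> to \<open>b\<close> there closes the loop: the signal
  \<open>v = S b\<close> satisfies \<open>v = S \<Delta> v\<close> at \<open>w\<close>.  But \<open>I - S \<Delta>\<close> has the stable inverse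
  \<open>I + T \<Delta>\<close>, where \<open>T\<close> is the inverse of the perturbed loop, so it is nonsingular at \<open>w\<close>.
\<close>

lemma norm_bound_necessary:
  fixes Sxx :: "('n::finite, 'n) tfmat" and Suu :: "('m::finite, 'm) tfmat"
    and Syy :: "('p::finite, 'p) tfmat"
  assumes S_def: "S = (Sxx ||| Sxu ||| Sxy) /// (Sux ||| Suu ||| Suy) /// (Syx ||| Syu ||| Syy)"
    and \<Phi>_def: "\<Phi> = (Sxx ||| Sxy) /// (Sux ||| Suy)"
    and S: "S \<in> RH_inf" "S ** Q = mat 1" "Q ** S = mat 1" and \<epsilon>: "\<epsilon> > 0"
    and robust: "\<And>\<Delta>A \<Delta>B \<Delta>C \<Delta>D. uncertainty \<Delta>A \<Delta>B \<Delta>C \<Delta>D \<in> uncertainty_set \<epsilon> \<Longrightarrow>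
      invertible (Q - uncertainty \<Delta>A \<Delta>B \<Delta>C \<Delta>D) \<and> matrix_inv (Q - uncertainty \<Delta>A \<Delta>B \<Delta>C \<Delta>D) \<in> RH_inf"
  shows "Hinf_norm \<Phi> \<le> inverse \<epsilon>"
proof (rule Hinf_norm_leI, rule ccontr)
  fix w0 b assume w0: "cmod w0 = 1" and "\<not> norm (mat_at \<Phi> w0 *v b) \<le> inverse \<epsilon> * norm b"
  then have gt: "norm (mat_at \<Phi> w0 *v b) > inverse \<epsilon> * norm b"
    by simp
  have \<Phi>_RH: "\<Phi> \<in> RH_inf"
    using S by (simp add: S_def \<Phi>_def RH_inf_vcat RH_inf_hcat)
  obtain w where w: "cmod w = 1" "Im w \<noteq> 0" and gt: "norm (mat_at \<Phi> w *v b) > inverse \<epsilon> * norm b"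
  proof -
    obtain t0 where t0: "w0 = cis t0"
      using cis_Arg[of w0] w0 by (metis div_by_1 norm_zero of_real_1 sgn_eq zero_neq_one)
    define h where "h t = norm (mat_at \<Phi> (cis t) *v b)" for t
    have "continuous_on UNIV h"
      unfolding h_def
      by (intro continuous_intros continuous_on_mat_at[OF \<Phi>_RH]) auto
    then have "isCont h t0"
      by (simp add: continuous_on_eq_continuous_at)
    moreover have "h t0 > inverse \<epsilon> * norm b"
      using gt by (simp add: h_def t0)
    ultimately have "eventually (\<lambda>t. h t > inverse \<epsilon> * norm b) (at t0)"
      unfolding isCont_def by (rule order_tendstoD(1))
    then obtain d where d: "d > 0" "\<And>t. t \<noteq> t0 \<Longrightarrow> \<bar>t - t0\<bar> < d \<Longrightarrow> h t > inverse \<epsilon> * norm b"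
      by (auto simp: eventually_at dist_real_def)
    show ?thesis
    proof (cases "sin t0 = 0")
      case False
      then show ?thesis
        using that[of w0] w0 gt t0 by simp
    next
      case True
      \<comment> \<open>a step small enough for the estimate, and less than \<open>\<pi>\<close> so that it leaves the real axis\<close>
      define s where "s = min (d / 2) 1"
      have s: "s > 0" "s < d" "s \<le> 1"
        using d by (auto simp: s_def)
      have "cos t0 \<noteq> 0"
        using True sin_cos_squared_add[of t0] by auto
      moreover have "sin s > 0"
        using s pi_gt3 by (intro sin_gt_zero) auto
      ultimately have "sin (t0 + s) \<noteq> 0"
        using True by (simp add: sin_add)
      then show ?thesis
        using that[of "cis (t0 + s)"] d(2)[of "t0 + s"] s by (simp add: h_def)
    qed
  qed
  define a where "a = mat_at \<Phi> w *v b"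
  have ab: "norm b < \<epsilon> * norm a"
    using gt \<epsilon> by (simp add: a_def field_simps)
  obtain \<Delta>A \<Delta>B \<Delta>C \<Delta>D
    where "uncertainty \<Delta>A \<Delta>B \<Delta>C \<Delta>D \<in> uncertainty_set \<epsilon>"
      and "\<And>v. proj_xu v = a \<Longrightarrow>
        mat_at (uncertainty \<Delta>A \<Delta>B \<Delta>C \<Delta>D :: ('n + 'm + 'p, 'n + 'm + 'p) tfmat) w *v v = embed_xy b"
    using rank_one_uncertainty[OF w ab] by metis
  moreover define \<Delta> where "\<Delta> = uncertainty \<Delta>A \<Delta>B \<Delta>C \<Delta>D"
  ultimately have \<Delta>: "\<Delta> \<in> RH_inf" "\<And>v. proj_xu v = a \<Longrightarrow> mat_at \<Delta> w *v v = embed_xy b"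
    and inv: "invertible (Q - \<Delta>)" "matrix_inv (Q - \<Delta>) \<in> RH_inf"
    using robust by (auto simp: uncertainty_in_set_iff)
  define T where "T = matrix_inv (Q - \<Delta>)"
  have "T ** (Q - \<Delta>) = mat 1"
    using matrix_inv_left[OF inv(1)] by (simp add: T_def)
  \<comment> \<open>\<open>Q\<close> contains \<open>z\<close> and is improper, so only the product \<open>T Q\<close> can be evaluated on the disc\<close>
  then have TQ: "T ** Q = mat 1 + T ** \<Delta>"
    by (simp add: matrix_diff_ldistrib algebra_simps)
  have "T ** Q ** (mat 1 - S ** \<Delta>) = T ** Q - T ** (Q ** S ** \<Delta>)"
    by (simp add: matrix_diff_ldistrib matrix_mul_assoc)
  then have id: "(mat 1 + T ** \<Delta>) ** (mat 1 - S ** \<Delta>) = mat 1"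
    by (simp add: TQ S)
  define v where "v = mat_at S w *v embed_xy b"
  have "proj_xu v = a"
    unfolding v_def a_def S_def \<Phi>_def by (rule proj_mat_at_embed)
  then have "v = mat_at S w *v (mat_at \<Delta> w *v v)"
    using \<Delta>(2) by (simp add: v_def)
  moreover have reg: "mat_regular_at S w" "mat_regular_at \<Delta> w" "mat_regular_at T w"
    using S(1) \<Delta>(1) inv(2) w by (auto intro: RH_infD simp: T_def)
  ultimately have "mat_at (mat 1 - S ** \<Delta>) w *v v = 0"
    by (simp add: mat_at_diff mat_at_mult mat_regular_at_mult matrix_vector_mult_diff_rdistrib
        flip: matrix_vector_mul_assoc)
  moreover have "mat_at ((mat 1 + T ** \<Delta>) ** (mat 1 - S ** \<Delta>)) w *v v =
      mat_at (mat 1 + T ** \<Delta>) w *v (mat_at (mat 1 - S ** \<Delta>) w *v v)"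
    using reg by (simp add: mat_at_mult mat_regular_at_mult mat_regular_at_add mat_regular_at_diff matrix_vector_mul_assoc)
  ultimately have "v = 0"
    by (simp add: id)
  then have "proj_xu v $ i = 0" for i
    by (cases i) (simp_all add: proj_xu_def)
  then have "a = 0"
    using \<open>proj_xu v = a\<close> by (simp add: vec_eq_iff)
  then show False
    using ab by simp
qed

section \<open>The parameterization\<close>

theorem corollary18:
  fixes A :: "real ^ 'n::finite ^ 'n"
    and B :: "real ^ 'm::finite ^ 'n"
    and C :: "real ^ 'n ^ 'p::finite"
    and D :: "real ^ 'm ^ 'p"
    and \<epsilon> :: real
    and K :: "('p, 'm) tfmat"
  assumes "\<epsilon> > 0"
  shows "K \<in> robust_controllers A B C D \<epsilon> \<longleftrightarrow>
    (\<exists>(\<Phi>xx :: ('n, 'n) tfmat) (\<Phi>ux :: ('n, 'm) tfmat) (\<Phi>xy :: ('p, 'n) tfmat) (\<Phi>uy :: ('p, 'm) tfmat).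
      (mat z_var - const_tf A ||| - const_tf B) ** ((\<Phi>xx ||| \<Phi>xy) /// (\<Phi>ux ||| \<Phi>uy)) = (mat 1 ||| 0) \<and>
      ((\<Phi>xx ||| \<Phi>xy) /// (\<Phi>ux ||| \<Phi>uy)) ** (mat z_var - const_tf A /// - const_tf C) = (mat 1 /// 0) \<and>
      \<Phi>xx \<in> zinv_RH_inf \<and> \<Phi>xy \<in> zinv_RH_inf \<and> \<Phi>ux \<in> zinv_RH_inf \<and> \<Phi>uy \<in> RH_inf \<and>
      Hinf_norm ((\<Phi>xx ||| \<Phi>xy) /// (\<Phi>ux ||| \<Phi>uy)) \<le> inverse \<epsilon> \<and>
      (let K0 = nominal_controller \<Phi>xx \<Phi>ux \<Phi>xy \<Phi>uy;
           M = mat 1 + const_tf D ** K0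
       in invertible M \<and> tf_proper (matrix_inv M) \<and> K = K0 ** matrix_inv M))"
  (is "_ \<longleftrightarrow> ?param")
proof -
  let ?A = "const_tf A" and ?B = "const_tf B" and ?C = "const_tf C" and ?D = "const_tf D"
  define Q where "Q = mat 1 - closed_loop ?A ?B ?C ?D K"
  have constraints_iff:
    "(mat z_var - ?A ||| - ?B) ** ((\<Phi>xx ||| \<Phi>xy) /// (\<Phi>ux ||| \<Phi>uy)) = (mat 1 ||| 0) \<and>
     ((\<Phi>xx ||| \<Phi>xy) /// (\<Phi>ux ||| \<Phi>uy)) ** (mat z_var - ?A /// - ?C) = (mat 1 /// 0) \<longleftrightarrow>
     (mat z_var - ?A) ** \<Phi>xx - ?B ** \<Phi>ux = mat 1 \<and> (mat z_var - ?A) ** \<Phi>xy - ?B ** \<Phi>uy = 0 \<and>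
     \<Phi>xx ** (mat z_var - ?A) - \<Phi>xy ** ?C = mat 1 \<and> \<Phi>ux ** (mat z_var - ?A) - \<Phi>uy ** ?C = 0"
    for \<Phi>xx :: "('n, 'n) tfmat" and \<Phi>ux :: "('n, 'm) tfmat" and \<Phi>xy :: "('p, 'n) tfmat"
      and \<Phi>uy :: "('p, 'm) tfmat"
    by (simp add: block_mult block_add hcat_eq_iff vcat_eq_iff matrix_mult_minus_left matrix_mult_minus_right)
  have stabilizes_iff: "internally_stabilizes K (?A + \<Delta>A) (?B + \<Delta>B) (?C + \<Delta>C) (?D + \<Delta>D) \<longleftrightarrow>
      invertible (Q - uncertainty \<Delta>A \<Delta>B \<Delta>C \<Delta>D) \<and> matrix_inv (Q - uncertainty \<Delta>A \<Delta>B \<Delta>C \<Delta>D) \<in> RH_inf"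
    for \<Delta>A \<Delta>B \<Delta>C \<Delta>D
    by (simp add: internally_stabilizes_def closed_loop_add_uncertainty diff_diff_eq Q_def)
  show ?thesis
  proof
    assume "K \<in> robust_controllers A B C D \<epsilon>"
    then have K: "tf_proper K" and robust: "\<And>\<Delta>A \<Delta>B \<Delta>C \<Delta>D. uncertainty \<Delta>A \<Delta>B \<Delta>C \<Delta>D \<in> uncertainty_set \<epsilon> \<Longrightarrow>
      invertible (Q - uncertainty \<Delta>A \<Delta>B \<Delta>C \<Delta>D) \<and> matrix_inv (Q - uncertainty \<Delta>A \<Delta>B \<Delta>C \<Delta>D) \<in> RH_inf"
      by (simp_all add: robust_controllers_def stabilizes_iff)
    have no_uncertainty: "uncertainty 0 0 0 0 = (0 :: ('n + 'm + 'p, 'n + 'm + 'p) tfmat)"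
      by (simp add: uncertainty_def vec_eq_iff split_sum_all)
    have "Hinf_norm (0 :: ('n + 'm + 'p, 'n + 'm + 'p) tfmat) \<le> 0"
      by (rule Hinf_norm_leI) simp
    then have "uncertainty 0 0 0 0 \<in> (uncertainty_set \<epsilon> :: ('n + 'm + 'p, 'n + 'm + 'p) tfmat set)"
      using \<open>\<epsilon> > 0\<close> by (subst uncertainty_in_set_iff) (simp add: no_uncertainty RH_inf_0)
    from robust[OF this] have inv: "invertible Q" and RH: "matrix_inv Q \<in> RH_inf"
      by (simp_all add: no_uncertainty)
    obtain Sxx Sxu Sxy Sux Suu Suy Syx Syu Syy
      where S_eq: "matrix_inv Q = (Sxx ||| Sxu ||| Sxy) /// (Sux ||| Suu ||| Suy) /// (Syx ||| Syu ||| Syy)"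
    proof -
      obtain Rx Ru Ry where "matrix_inv Q = Rx /// Ru /// Ry"
        using vcat_exhaust by metis
      moreover obtain Sxx Sxu Sxy where "Rx = Sxx ||| Sxu ||| Sxy"
        using hcat_exhaust by metis
      moreover obtain Sux Suu Suy where "Ru = Sux ||| Suu ||| Suy"
        using hcat_exhaust by metis
      moreover obtain Syx Syu Syy where "Ry = Syx ||| Syu ||| Syy"
        using hcat_exhaust by metis
      ultimately show ?thesis
        using that by simp
    qed
    let ?S = "(Sxx ||| Sxu ||| Sxy) /// (Sux ||| Suu ||| Suy) /// (Syx ||| Syu ||| Syy)"
    have left: "?S ** Q = mat 1" and right: "Q ** ?S = mat 1"
      using matrix_inv_left[OF inv] matrix_inv_right[OF inv] by (simp_all add: S_eq)
    have x_eqs: "(mat z_var - ?A) ** Sxx - ?B ** Sux = mat 1" "(mat z_var - ?A) ** Sxy - ?B ** Suy = 0"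
      and u_eqs: "Sux = K ** Syx" "Suy = K ** Syy"
      and y_eqs: "Syx = ?C ** Sxx + ?D ** Sux" "Syy = mat 1 + ?C ** Sxy + ?D ** Suy"
      using right[unfolded Q_def right_inverse_closed_loop_iff] by blast+
    note left_eqs = left_inverse_closed_loopD[OF left[unfolded Q_def]]
    have RHs: "Sxx \<in> RH_inf" "Sxy \<in> RH_inf" "Sux \<in> RH_inf" "Suy \<in> RH_inf"
      using RH by (simp_all add: S_eq RH_inf_vcat RH_inf_hcat)
    have "mat z_var ** Sxx = mat 1 + ?A ** Sxx + ?B ** Sux"
      using x_eqs(1) by (simp add: matrix_diff_rdistrib algebra_simps)
    then have xx: "Sxx \<in> zinv_RH_inf"
      using RHs by (simp add: zinv_RH_inf_iff RH_inf_closed)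
    have "mat z_var ** Sxy = ?A ** Sxy + ?B ** Suy"
      using x_eqs(2) by (simp add: matrix_diff_rdistrib algebra_simps)
    then have xy: "Sxy \<in> zinv_RH_inf"
      using RHs by (simp add: zinv_RH_inf_iff RH_inf_closed)
    \<comment> \<open>\<open>z Sux\<close> does not occur in the state row of the right-inverse equation, only in the left one\<close>
    have "mat z_var ** Sux = Sux ** ?A + Suy ** ?C"
      using left_eqs(2) by (simp add: matrix_diff_ldistrib algebra_simps mat_mult_commute)
    then have ux: "Sux \<in> zinv_RH_inf"
      using RHs by (simp add: zinv_RH_inf_iff RH_inf_closed)
    have bound: "Hinf_norm ((Sxx ||| Sxy) /// (Sux ||| Suy)) \<le> inverse \<epsilon>"
      by (rule norm_bound_necessary[OF S_eq refl RH matrix_inv_left[OF inv] matrix_inv_right[OF inv]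
            \<open>\<epsilon> > 0\<close> robust])
    define K0 where "K0 = nominal_controller Sxx Sux Sxy Suy"
    define M where "M = mat 1 + ?D ** K0"
    have "invertible Sxx"
      by (rule invertible_state_map[OF x_eqs(1) xx ux])
    then have K0: "K0 = K ** M"
      unfolding K0_def M_def by (rule nominal_controller_fixed_point[OF u_eqs y_eqs])
    then have "(mat 1 - ?D ** K) ** M = mat 1"
      by (simp add: matrix_diff_rdistrib matrix_mul_assoc[symmetric]) (simp add: M_def)
    then have "M ** (mat 1 - ?D ** K) = mat 1"
      by (simp add: matrix_left_right_inverse)
    note M = invertibleI_right[OF this] matrix_inv_eqI[OF this]
    have "tf_proper (matrix_inv M)"
      using K by (simp add: M(2) tf_proper_iff mat_regular_at_diff mat_regular_at_mult)
    moreover have "K = K0 ** matrix_inv M"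
      using matrix_inv_right[OF M(1)] by (simp add: K0 matrix_mul_assoc[symmetric])
    moreover have "(mat z_var - ?A ||| - ?B) ** ((Sxx ||| Sxy) /// (Sux ||| Suy)) = (mat 1 ||| 0) \<and>
      ((Sxx ||| Sxy) /// (Sux ||| Suy)) ** (mat z_var - ?A /// - ?C) = (mat 1 /// 0)"
      unfolding constraints_iff using left_eqs x_eqs by blast
    ultimately show ?param
      using M(1) xx xy ux RHs(4) bound unfolding K0_def M_def Let_def
      by (intro exI[of _ Sxx] exI[of _ Sux] exI[of _ Sxy] exI[of _ Suy]) (elim conjE, intro conjI)
  next
    assume ?param
    then obtain \<Phi>xx :: "('n, 'n) tfmat" and \<Phi>ux :: "('n, 'm) tfmat"
        and \<Phi>xy :: "('p, 'n) tfmat" and \<Phi>uy :: "('p, 'm) tfmat"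
      where constraints:
        "(mat z_var - ?A ||| - ?B) ** ((\<Phi>xx ||| \<Phi>xy) /// (\<Phi>ux ||| \<Phi>uy)) = (mat 1 ||| 0)"
        "((\<Phi>xx ||| \<Phi>xy) /// (\<Phi>ux ||| \<Phi>uy)) ** (mat z_var - ?A /// - ?C) = (mat 1 /// 0)"
        and strict: "\<Phi>xx \<in> zinv_RH_inf" "\<Phi>xy \<in> zinv_RH_inf" "\<Phi>ux \<in> zinv_RH_inf"
        and uy: "\<Phi>uy \<in> RH_inf"
        and bound: "Hinf_norm ((\<Phi>xx ||| \<Phi>xy) /// (\<Phi>ux ||| \<Phi>uy)) \<le> inverse \<epsilon>"
        and M: "invertible (mat 1 + ?D ** nominal_controller \<Phi>xx \<Phi>ux \<Phi>xy \<Phi>uy)"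
          "tf_proper (matrix_inv (mat 1 + ?D ** nominal_controller \<Phi>xx \<Phi>ux \<Phi>xy \<Phi>uy))"
        and K: "K = nominal_controller \<Phi>xx \<Phi>ux \<Phi>xy \<Phi>uy **
          matrix_inv (mat 1 + ?D ** nominal_controller \<Phi>xx \<Phi>ux \<Phi>xy \<Phi>uy)"
      unfolding Let_def by blast
    note eqs = conjI[OF constraints, unfolded constraints_iff]
    have inv: "invertible \<Phi>xx"
      using eqs strict by (intro invertible_state_map[of A \<Phi>xx B \<Phi>ux]) auto
    have "tf_proper (nominal_controller \<Phi>xx \<Phi>ux \<Phi>xy \<Phi>uy)"
      using eqs strict uy by (intro nominal_controller_proper[of A _ B]) auto
    then have K_proper: "tf_proper K"
      using M(2) unfolding K by (simp add: tf_proper_iff mat_regular_at_mult)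
    define Sxu where "Sxu = \<Phi>xx ** ?B + \<Phi>xy ** ?D"
    define Suu where "Suu = mat 1 + \<Phi>ux ** ?B + \<Phi>uy ** ?D"
    define S where "S = (\<Phi>xx ||| Sxu ||| \<Phi>xy) /// (\<Phi>ux ||| Suu ||| \<Phi>uy) ///
      (?C ** \<Phi>xx + ?D ** \<Phi>ux ||| ?C ** Sxu + ?D ** Suu ||| mat 1 + ?C ** \<Phi>xy + ?D ** \<Phi>uy)"
    have QS: "Q ** S = mat 1"
      unfolding Q_def S_def Sxu_def Suu_def
      using eqs inv M(1) K by (intro closed_loop_inverse_from_maps) auto
    have S_RH: "S \<in> RH_inf"
      using strict uy
      by (simp add: S_def Sxu_def Suu_def RH_inf_vcat RH_inf_hcat RH_inf_closed zinv_RH_inf_subset_RH_inf)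
    have "internally_stabilizes K (?A + \<Delta>A) (?B + \<Delta>B) (?C + \<Delta>C) (?D + \<Delta>D)"
      if \<Delta>: "(uncertainty \<Delta>A \<Delta>B \<Delta>C \<Delta>D :: ('n + 'm + 'p, 'n + 'm + 'p) tfmat) \<in> uncertainty_set \<epsilon>"
      for \<Delta>A \<Delta>B \<Delta>C \<Delta>D
    proof -
      define \<Delta> where "\<Delta> = uncertainty \<Delta>A \<Delta>B \<Delta>C \<Delta>D"
      have \<Delta>': "\<Delta> \<in> RH_inf" "Hinf_norm \<Delta> < \<epsilon>"
        using that by (simp_all add: \<Delta>_def uncertainty_in_set_iff)
      have sg: "invertible (mat 1 - S ** \<Delta>)" "matrix_inv (mat 1 - S ** \<Delta>) \<in> RH_inf"
        using small_gain[OF S_def refl S_RH \<open>\<epsilon> > 0\<close> bound \<Delta>'(1) \<Delta>_def \<Delta>'(2)] .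
      have "Q - \<Delta> = Q ** (mat 1 - S ** \<Delta>)"
        using QS by (simp add: matrix_diff_ldistrib matrix_mul_assoc)
      then have "(Q - \<Delta>) ** (matrix_inv (mat 1 - S ** \<Delta>) ** S) = mat 1"
        using matrix_inv_right[OF sg(1)] QS
        by (metis (no_types) matrix_mul_assoc matrix_mul_rid)
      note invertibleI_right[OF this] matrix_inv_eqI[OF this]
      then show ?thesis
        using sg(2) S_RH unfolding stabilizes_iff \<Delta>_def[symmetric] by (simp add: RH_inf_mult)
    qed
    then show "K \<in> robust_controllers A B C D \<epsilon>"
      using K_proper by (simp add: robust_controllers_def)
  qed
qed

end
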